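(* For every $n\ge3$, we have $$\mathbb{E}[H_{0,n}]=\mathbb{E}[H_{2,n}]=\frac{n}{2}\left(1+\frac{1}{3^{n-2}}\right),\qquad \mathbb{E}[H_{1,n}]=n\left(1-\frac{1}{3^{n-2}}\right).$$
   Context: Let $n\ge3$. Select $n$ i.i.d. points uniformly at random on the unit circle and label them $P_1,\ldots,P_n$ in counterclockwise cyclic order. Let $L_i$ be the perpendicular bisector of $[P_i,P_{i+1}]$ (indices modulo $n$). Almost surely these $n$ lines are pairwise distinct and contain none of the points; they all pass through the center of the circle and divide the plane into $2n$ regions. The antipodal region of a region is its image under $z\mapsto -z$ (again one of the $2n$ regions). For $k\in\{0,1,2\}$, a region is of type $k$ if the total number of points $P_j$ contained in the union of the region with its antipodal region is $k$. $H_{k,n}$ is the number of regions of type $k$ (among the $2n$ regions). *)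

theory Defs
  imports "HOL-Probability.Probability"
begin

definition uniform_circle :: "complex measure" where
  "uniform_circle =
     distr (uniform_measure lborel {0..<2 * pi}) (restrict_space borel (sphere 0 1)) cis"

text \<open>
  \<open>ccw_labelling n X P\<close>: \<open>P 0, \<dots>, P (n - 1)\<close> is a relabelling of the points \<open>X 0, \<dots>, X (n - 1)\<close>
  of the unit circle in counterclockwise cyclic order; the starting point is arbitrary. The
  inequalities between the angles are weak so that a labelling exists for every configuration.
  If two of the points coincide, then two cyclically consecutive labels coincide, the
  corresponding set \<open>perp_bisector\<close> is the whole plane, and there are no regions at all.
\<close>

definition ccw_labelling :: "nat \<Rightarrow> (nat \<Rightarrow> complex) \<Rightarrow> (nat \<Rightarrow> complex) \<Rightarrow> bool" where
  "ccw_labelling n X P \<longleftrightarrow>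
     (\<exists>\<sigma> \<theta>. bij_betw \<sigma> {..<n} {..<n} \<and>
        (\<forall>i<n. P i = X (\<sigma> i) \<and> P i = cis (\<theta> i)) \<and>
        (\<forall>i j. i \<le> j \<and> j < n \<longrightarrow> \<theta> i \<le> \<theta> j) \<and>
        (\<forall>i<n. \<theta> i \<le> \<theta> 0 + 2 * pi))"

definition perp_bisector :: "complex \<Rightarrow> complex \<Rightarrow> complex set" where
  "perp_bisector a b = {z. (z - midpoint a b) \<bullet> (b - a) = 0}"

definition regions :: "nat \<Rightarrow> (nat \<Rightarrow> complex) \<Rightarrow> complex set set" where
  "regions n P = components (- (\<Union>i<n. perp_bisector (P i) (P (Suc i mod n))))"

definition region_type :: "nat \<Rightarrow> (nat \<Rightarrow> complex) \<Rightarrow> complex set \<Rightarrow> nat" where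
  "region_type n P R = card {j. j < n \<and> P j \<in> R \<union> uminus ` R}"

definition H :: "nat \<Rightarrow> nat \<Rightarrow> (nat \<Rightarrow> complex) \<Rightarrow> nat" where
  "H k n P = card {R \<in> regions n P. region_type n P R = k}"

end

theory Submission
  imports Defs
begin

text \<open>
  The bisectors are lines through the origin, so the regions are the nonempty cells of points with
  prescribed signs of the inner products with the chords \<open>P (i + 1) - P i\<close>, and \<open>n\<close> pairwise distinct
  lines through the origin have \<open>2 * n\<close> cells. A cell contains at most one of the points, so the type
  of a region is at most \<open>2\<close>, and counting incidences gives \<open>H 0 = H 2\<close> and \<open>H 1 + 2 * H 2 = 2 * n\<close>
  outside a null set. A region has type \<open>2\<close> iff it contains some \<open>P a\<close> while its antipode contains
  some \<open>P b\<close>. Since the inner product with \<open>P a\<close> is unimodal along the circle, this happens iff \<open>P a\<close>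
  and \<open>P b\<close> are the farthest points from each other, so \<open>H 2\<close> is the number of ordered mutually
  farthest pairs. If the points \<open>u\<close>, \<open>v\<close> of such a pair are at angular distance \<open>b\<close>, then the other
  \<open>n - 2\<close> points lie in a set of arc length \<open>max b (4 * b - 2 * pi)\<close>; integrating the \<open>(n - 2)\<close>-nd power
  of its probability over \<open>v\<close> gives \<open>(1 + 1 / 3 ^ (n - 2)) / (2 * (n - 1))\<close>, for each of \<open>n * (n - 1)\<close> pairs.
\<close>

section \<open>Cells of central line arrangements\<close>

text \<open>On the unit circle a larger inner product means a smaller distance. So the sign of the
  inner product of \<open>p i\<close> with the chord from \<open>p e\<close> to
  \<open>p (Suc e)\<close> tells whether this step approaches \<open>p i\<close> (positive) or moves
  away from it (negative). Unimodality makes the signs negative on the way from \<open>p i\<close>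
  to its farthest point and positive on the way back; seen from a mutually farthest partner, all
  signs are reversed. The equality of the counts for types 0 and 2 is inclusion-exclusion: n
  occupied cells and the n antipodes of occupied cells, among 2n cells, leave uncovered as many
  cells as they cover twice. The number 3 comes from the angular distance \<open>2 * pi / 3\<close>:
  up to there the other points are confined to the arc between \<open>u\<close> and
  \<open>v\<close>, and beyond it a second arc opens on the far side. At this threshold the
  admissible probability is 1/3, and its power survives the integration.\<close>

definition cell :: "('i \<Rightarrow> 'a::real_inner) \<Rightarrow> 'i set \<Rightarrow> 'i set \<Rightarrow> 'a set" where
  "cell w I A = {z. \<forall>i\<in>I. if i \<in> A then z \<bullet> w i > 0 else z \<bullet> w i < 0}"

lemma cell_convex: "convex (cell w I A)"
proof -
  have "cell w I A = (\<Inter>i\<in>I. if i \<in> A then {z. w i \<bullet> z > 0} else {z. w i \<bullet> z < 0})"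
    by (auto simp: cell_def inner_commute split: if_splits)
  moreover have "convex \<dots>"
    by (intro convex_INT) (auto simp: convex_halfspace_lt convex_halfspace_gt)
  ultimately show ?thesis by simp
qed

lemma cell_open: "finite I \<Longrightarrow> open (cell w I A)"
proof -
  assume "finite I"
  have "cell w I A = (\<Inter>i\<in>I. if i \<in> A then {z. w i \<bullet> z > 0} else {z. w i \<bullet> z < 0})"
    by (auto simp: cell_def inner_commute split: if_splits)
  moreover have "open \<dots>"
    using \<open>finite I\<close> by (intro open_INT) (auto simp: open_halfspace_lt open_halfspace_gt)
  ultimately show ?thesis by simp
qed

lemma mem_cell_iff:
  assumes "A \<subseteq> I"
  shows "z \<in> cell w I A \<longleftrightarrow> (\<forall>i\<in>I. z \<bullet> w i \<noteq> 0) \<and> A = {i\<in>I. z \<bullet> w i > 0}"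
  using assms unfolding cell_def by (auto simp: not_less_iff_gr_or_eq split: if_splits)

lemma mem_cell_unique:
  assumes "z \<in> cell w I A" "z \<in> cell w I B" "A \<subseteq> I" "B \<subseteq> I"
  shows "A = B"
  using assms by (simp add: mem_cell_iff)

lemma uminus_cell: "A \<subseteq> I \<Longrightarrow> uminus ` cell w I A = cell w I (I - A)"
proof -
  assume "A \<subseteq> I"
  have "z \<in> uminus ` cell w I A \<longleftrightarrow> - z \<in> cell w I A" for z
    by (metis image_eqI imageE minus_minus)
  then have "uminus ` cell w I A = {z. - z \<in> cell w I A}" by blast
  also have "\<dots> = cell w I (I - A)" by (auto simp: cell_def split: if_splits)
  finally show ?thesis .
qed

text \<open>By the intermediate value theorem a linear form without zeros on a connected set keeps
  its sign there.\<close>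

lemma connected_subset_cell:
  assumes T: "connected T" "T \<subseteq> {z. \<forall>i\<in>I. z \<bullet> w i \<noteq> 0}" and "y \<in> T" "y \<in> cell w I A"
  shows "T \<subseteq> cell w I A"
proof
  fix x assume "x \<in> T"
  have pos: "x \<bullet> w i > 0 \<longleftrightarrow> y \<bullet> w i > 0" if "i \<in> I" for i
  proof -
    have "\<exists>z\<in>T. w i \<bullet> z = 0" if "a \<in> T" "b \<in> T" "a \<bullet> w i \<le> 0" "0 \<le> b \<bullet> w i" for a b
      using connected_ivt_hyperplane[OF T(1) that(1,2), of "w i" 0] that(3,4) by (auto simp: inner_commute)
    then have "\<not> (a \<bullet> w i \<le> 0 \<and> 0 \<le> b \<bullet> w i)" if "a \<in> T" "b \<in> T" for a b
      using T(2) that \<open>i \<in> I\<close> by (auto simp: inner_commute)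
    from this[of x y] this[of y x] \<open>x \<in> T\<close> \<open>y \<in> T\<close> show ?thesis by linarith
  qed
  have "if i \<in> A then x \<bullet> w i > 0 else x \<bullet> w i < 0" if "i \<in> I" for i
  proof -
    have "x \<bullet> w i \<noteq> 0" using T(2) \<open>x \<in> T\<close> that by auto
    moreover have "if i \<in> A then y \<bullet> w i > 0 else y \<bullet> w i < 0"
      using \<open>y \<in> cell w I A\<close> that by (auto simp: cell_def)
    ultimately show ?thesis using pos[OF that] by (cases "i \<in> A") auto
  qed
  then show "x \<in> cell w I A" unfolding cell_def by blast
qed

text \<open>Nonempty cells are convex, hence connected, and no larger connected set avoids the
  lines. Indexing by sign patterns \<open>A\<close> turns the count of components into a count of
  finite sets.\<close>

lemma components_eq_cells:
  "components (- (\<Union>i\<in>I. {z. z \<bullet> w i = 0})) = cell w I ` {A \<in> Pow I. cell w I A \<noteq> {}}"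
proof -
  define U where "U = {z. \<forall>i\<in>I. z \<bullet> w i \<noteq> 0}"
  have U: "- (\<Union>i\<in>I. {z. z \<bullet> w i = 0}) = U" by (auto simp: U_def)
  have cc: "cell w I A \<in> components U" if "cell w I A \<noteq> {}" for A
  proof -
    have "cell w I A \<subseteq> U" by (auto simp: cell_def U_def split: if_splits)
    moreover have "connected (cell w I A)" by (intro convex_connected cell_convex)
    moreover have "T = cell w I A" if "T \<noteq> {}" "cell w I A \<subseteq> T" "T \<subseteq> U" "connected T" for T
      using connected_subset_cell[of T I w _ A] that \<open>cell w I A \<noteq> {}\<close> unfolding U_def by blast
    ultimately show ?thesis using that unfolding in_components_maximal by blast
  qed
  have "C \<in> cell w I ` {A \<in> Pow I. cell w I A \<noteq> {}}" if C: "C \<in> components U" for C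
  proof -
    obtain z where z: "z \<in> C" using in_components_nonempty[OF C] by blast
    then have zU: "z \<in> U" using in_components_subset[OF C] by blast
    define A where "A = {i\<in>I. z \<bullet> w i > 0}"
    have zA: "z \<in> cell w I A" using zU mem_cell_iff[of A I z w] by (auto simp: A_def U_def)
    then have "C = cell w I A" using components_eq[OF C cc] z by auto
    then show ?thesis using zA by (auto simp: A_def)
  qed
  then show ?thesis using cc unfolding U by blast
qed

lemma inj_on_cell: "inj_on (cell w I) {A \<in> Pow I. cell w I A \<noteq> {}}"
proof (rule inj_onI)
  fix A B assume "A \<in> {A \<in> Pow I. cell w I A \<noteq> {}}" "B \<in> {A \<in> Pow I. cell w I A \<noteq> {}}"
    and "cell w I A = cell w I B"
  then show "A = B" using mem_cell_unique[of _ w I A B] by blast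
qed

text \<open>The property \<open>Q\<close> is left open so that the same translation serves the
  combinatorial count and the measurability proof.\<close>

lemma card_components_cells:
  "card {R \<in> components (- (\<Union>i\<in>I. {z. z \<bullet> w i = 0})). Q R}
     = card {A \<in> Pow I. cell w I A \<noteq> {} \<and> Q (cell w I A)}"
proof -
  have "{R \<in> components (- (\<Union>i\<in>I. {z. z \<bullet> w i = 0})). Q R}
      = cell w I ` {A \<in> Pow I. cell w I A \<noteq> {} \<and> Q (cell w I A)}"
    unfolding components_eq_cells by auto
  moreover have "inj_on (cell w I) {A \<in> Pow I. cell w I A \<noteq> {} \<and> Q (cell w I A)}"
    by (rule inj_on_subset[OF inj_on_cell]) auto
  ultimately show ?thesis by (simp only: card_image)
qed

lemma cell_insert:
  assumes "x \<notin> I" "A \<subseteq> I"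
  shows "cell w (insert x I) A = cell w I A \<inter> {z. z \<bullet> w x < 0}"
    and "cell w (insert x I) (insert x A) = cell w I A \<inter> {z. z \<bullet> w x > 0}"
  using assms by (auto simp: cell_def split: if_splits)

text \<open>Since the cell is open, a point of it on the line orthogonal to \<open>v\<close> can be
  pushed slightly along \<open>v\<close> and along \<open>- v\<close> without leaving the cell. A
  cell met by a new line thus reaches both of its sides.\<close>

lemma cell_perturb:
  fixes w :: "'i \<Rightarrow> 'a::real_inner"
  assumes "finite I" "z \<in> cell w I A" "z \<bullet> v = 0" "v \<noteq> 0"
  shows "\<exists>y\<in>cell w I A. y \<bullet> v > 0" "\<exists>y\<in>cell w I A. y \<bullet> v < 0"
proof -
  obtain e where e: "e > 0" "ball z e \<subseteq> cell w I A"
    using cell_open[OF assms(1)] assms(2) open_contains_ball by blast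
  define d where "d = e / (2 * norm v)"
  have d: "d > 0" using e assms(4) by (simp add: d_def)
  have nd: "norm (d *\<^sub>R v) < e" using e assms(4) by (simp add: d_def)
  have "v \<bullet> v > 0" using assms(4) by simp
  then have "(z + d *\<^sub>R v) \<bullet> v > 0" "(z - d *\<^sub>R v) \<bullet> v < 0"
    using d assms(3) by (auto simp: inner_add_left inner_diff_left)
  moreover have "z + d *\<^sub>R v \<in> ball z e" "z - d *\<^sub>R v \<in> ball z e"
    using nd by (auto simp: dist_norm)
  ultimately show "\<exists>y\<in>cell w I A. y \<bullet> v > 0" "\<exists>y\<in>cell w I A. y \<bullet> v < 0"
    using e by blast+
qed

text \<open>The plane enters here: the orthogonal complement of \<open>v\<close> is one-dimensional
  and spanned by the quarter turn of \<open>v\<close>.\<close>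

lemma complex_orthogonal_multiple:
  fixes z v :: complex
  assumes "z \<bullet> v = 0" "v \<noteq> 0"
  obtains t where "z = t *\<^sub>R (\<i> * v)"
proof -
  define t where "t = (z \<bullet> (\<i> * v)) / (v \<bullet> v)"
  have vv: "v \<bullet> v \<noteq> 0" using assms by simp
  have "z = t *\<^sub>R (\<i> * v)"
  proof (rule complex_eqI)
    have *: "Re z * Re v + Im z * Im v = 0" using assms(1) by (simp add: inner_complex_def)
    have vv': "Re v * Re v + Im v * Im v \<noteq> 0" using vv by (simp add: inner_complex_def)
    have "Re z * (Re v * Re v + Im v * Im v) = - (Im z * Re v - Re z * Im v) * Im v"
      using * by algebra
    then show "Re z = Re (t *\<^sub>R (\<i> * v))"
      using vv' by (simp add: t_def inner_complex_def field_simps)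
    have "Im z * (Re v * Re v + Im v * Im v) = (Im z * Re v - Re z * Im v) * Re v"
      using * by algebra
    then show "Im z = Im (t *\<^sub>R (\<i> * v))"
      using vv' by (simp add: t_def inner_complex_def field_simps)
  qed
  then show thesis by (rule that)
qed

text \<open>Induction on the number of lines: the two rays of a new line lie in two opposite cells of the
  old arrangement, and these are the only cells that it cuts.\<close>

lemma card_cells:
  fixes w :: "'i \<Rightarrow> complex"
  assumes "finite I" "I \<noteq> {}"
    and "\<And>i. i \<in> I \<Longrightarrow> w i \<noteq> 0"
    and "\<And>i j. i \<in> I \<Longrightarrow> j \<in> I \<Longrightarrow> i \<noteq> j \<Longrightarrow> (\<i> * w i) \<bullet> w j \<noteq> 0"
  shows "card {A \<in> Pow I. cell w I A \<noteq> {}} = 2 * card I"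
  using assms
proof (induction I rule: finite_ne_induct)
  case (singleton x)
  have "w x \<bullet> w x > 0" using singleton(1)[of x] by simp
  then have "w x \<in> cell w {x} {x}" "- w x \<in> cell w {x} {}"
    by (simp_all add: cell_def)
  then have "{A \<in> Pow {x}. cell w {x} A \<noteq> {}} = {{}, {x}}" by (auto dest: subset_singletonD)
  then show ?case by simp
next
  case (insert x I)
  define S where "S = {A \<in> Pow I. cell w I A \<noteq> {}}"
  \<comment> \<open>An old cell in \<open>S1\<close> reaches the negative side of the new line and
    one in \<open>S2\<close> the positive side; those in both are cut in two.\<close>
  define S1 where "S1 = {A \<in> Pow I. \<exists>z\<in>cell w I A. z \<bullet> w x < 0}"
  define S2 where "S2 = {A \<in> Pow I. \<exists>z\<in>cell w I A. z \<bullet> w x > 0}"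
  \<comment> \<open>A direction vector of the new line; \<open>r\<close> and \<open>- r\<close> span
    its two rays.\<close>
  define r where "r = \<i> * w x"
  have wx: "w x \<noteq> 0" using insert.prems(1) by simp
  have fin: "finite S1" "finite S2" using insert(1) by (auto simp: S1_def S2_def)
  have cS: "card S = 2 * card I" unfolding S_def
    using insert.IH insert.prems by blast
  have un: "S1 \<union> S2 = S"
  proof -
    have "A \<in> S1 \<union> S2" if AS: "A \<in> S" for A
    proof -
      obtain z where z: "z \<in> cell w I A" using AS unfolding S_def by blast
      consider "z \<bullet> w x < 0" | "z \<bullet> w x > 0" | "z \<bullet> w x = 0" by linarith
      then show ?thesis
        using AS z cell_perturb(1)[OF insert(1) z _ wx] by cases (auto simp: S_def S1_def S2_def)
    qed
    then show ?thesis by (auto simp: S_def S1_def S2_def)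
  qed
  have rx: "r \<bullet> w x = 0" by (simp add: r_def inner_complex_def)
  have rI: "r \<bullet> w i \<noteq> 0" if "i \<in> I" for i
    using insert.prems(2)[of x i] insert(3) that by (auto simp: r_def)
  define A1 where "A1 = {i\<in>I. r \<bullet> w i > 0}"
  have r1: "r \<in> cell w I A1" and r2: "- r \<in> cell w I (I - A1)"
    using rI by (force simp: cell_def A1_def not_less_iff_gr_or_eq)+
  have int: "S1 \<inter> S2 = {A1, I - A1}"
  proof -
    have "A1 \<in> S1 \<inter> S2"
      using cell_perturb[OF insert(1) r1 rx wx] by (auto simp: S1_def S2_def A1_def)
    moreover have "I - A1 \<in> S1 \<inter> S2"
      using cell_perturb[OF insert(1) r2 _ wx] rx by (auto simp: S1_def S2_def A1_def)
    moreover have "A \<in> {A1, I - A1}" if A: "A \<in> S1 \<inter> S2" for A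
    proof -
      obtain y z where yz: "y \<in> cell w I A" "y \<bullet> w x < 0" "z \<in> cell w I A" "z \<bullet> w x > 0"
        using A by (auto simp: S1_def S2_def)
      have "\<exists>q\<in>cell w I A. w x \<bullet> q = 0"
        using connected_ivt_hyperplane[OF convex_connected[OF cell_convex] yz(1,3), of "w x" 0] yz
        by (auto simp: inner_commute)
      then obtain q where q: "q \<in> cell w I A" "q \<bullet> w x = 0" by (auto simp: inner_commute)
      obtain t where t: "q = t *\<^sub>R r"
        using complex_orthogonal_multiple[OF q(2) wx] unfolding r_def by metis
      obtain i where i: "i \<in> I" using insert(2) by blast
      have "q \<noteq> 0" using q(1) i by (auto simp: cell_def split: if_splits)
      then have "t \<noteq> 0" using t by auto
      have AI: "A \<subseteq> I" using A by (auto simp: S1_def)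
      \<comment> \<open>The sign pattern of \<open>q = t *\<^sub>R r\<close> is that of
        \<open>r\<close> or its complement, according to the sign of \<open>t\<close>.\<close>
      then have A_eq: "A = {i\<in>I. t * (r \<bullet> w i) > 0}"
        using q(1) mem_cell_iff[OF AI, of q w] by (simp add: t)
      show ?thesis
      proof (cases "t > 0")
        case True
        then have "A = A1" unfolding A_eq A1_def by (simp add: zero_less_mult_iff)
        then show ?thesis by simp
      next
        case False
        with \<open>t \<noteq> 0\<close> have "t < 0" by simp
        then have "A = I - A1" unfolding A_eq A1_def using rI
          by (auto simp: zero_less_mult_iff not_less_iff_gr_or_eq)
        then show ?thesis by simp
      qed
    qed
    ultimately show ?thesis by blast
  qed
  \<comment> \<open>Nonemptiness of \<open>I\<close> makes the two cut cells different. The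
    induction therefore starts at one line; without lines there is one cell, not
    \<open>2 * 0\<close>.\<close>
  have "A1 \<noteq> I - A1" using insert(2) by blast
  then have cint: "card (S1 \<inter> S2) = 2" by (simp add: int)
  have S': "{A \<in> Pow (insert x I). cell w (insert x I) A \<noteq> {}} = S1 \<union> insert x ` S2"
  proof (intro set_eqI iffI)
    fix A assume A: "A \<in> {A \<in> Pow (insert x I). cell w (insert x I) A \<noteq> {}}"
    show "A \<in> S1 \<union> insert x ` S2"
    proof (cases "x \<in> A")
      case True
      define B where "B = A - {x}"
      have B: "B \<subseteq> I" "A = insert x B" using A True insert(3) by (auto simp: B_def)
      then have "B \<in> S2" using A cell_insert(2)[OF insert(3) B(1), of w] by (auto simp: S2_def)
      then show ?thesis using B by auto
    next
      case False
      then have B: "A \<subseteq> I" using A by auto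
      then have "A \<in> S1" using A cell_insert(1)[OF insert(3) B(1), of w] by (auto simp: S1_def)
      then show ?thesis by auto
    qed
  next
    fix A assume "A \<in> S1 \<union> insert x ` S2"
    then show "A \<in> {A \<in> Pow (insert x I). cell w (insert x I) A \<noteq> {}}"
      using insert(3) by (auto simp: S1_def S2_def cell_insert)
  qed
  have "card (S1 \<union> insert x ` S2) = card S1 + card (insert x ` S2)"
    using insert(3) fin by (intro card_Un_disjoint) (auto simp: S1_def S2_def)
  also have "card (insert x ` S2) = card S2"
  proof (rule card_image, rule inj_onI)
    fix A B assume "A \<in> S2" "B \<in> S2" "insert x A = insert x B"
    moreover from this have "x \<notin> A" "x \<notin> B" using insert(3) by (auto simp: S2_def)
    ultimately show "A = B" using insert_ident[of x A B] by blast
  qed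
  also have "card S1 + card S2 = card S + 2"
    using card_Un_Int[OF fin] un cint by simp
  finally show ?case unfolding S' using cS insert(1,3) by simp
qed

section \<open>Points in cyclic order\<close>

text \<open>From \<open>cos t = - cos \<bar>t - pi\<bar>\<close> and the monotonicity of cosine on
  the interval from 0 to pi. Comparisons of inner products become comparisons of distances to pi,
  and unimodality becomes the convexity of the absolute value, within reach of linear
  arithmetic.\<close>

lemma cos_less_iff_dist_pi:
  assumes "0 \<le> x" "x \<le> 2 * pi" "0 \<le> y" "y \<le> 2 * pi"
  shows "cos x < cos y \<longleftrightarrow> \<bar>x - pi\<bar> < \<bar>y - pi\<bar>"
proof -
  have *: "cos t = - cos \<bar>t - pi\<bar>" for t
    by (simp add: abs_if cos_diff)
  show ?thesis
    unfolding *[of x] *[of y] using assms cos_mono_less_eq[of "\<bar>y - pi\<bar>" "\<bar>x - pi\<bar>"]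
    by (auto simp: abs_if)
qed

lemma inner_cis: "cis a \<bullet> cis b = cos (b - a)"
  by (simp add: inner_complex_def cos_diff mult.commute)

text \<open>The angles are continued to all natural indices, gaining one full turn every
  \<open>n\<close> steps. A walk around the circle from any point then has increasing angles and
  never wraps.\<close>

locale ccw_cycle =
  fixes n :: nat and \<theta> :: "nat \<Rightarrow> real"
  assumes n: "n \<ge> 2"
    and smono: "strict_mono \<theta>"
    and period: "\<theta> (i + n) = \<theta> i + 2 * pi"
begin

definition p :: "nat \<Rightarrow> complex" where "p i = cis (\<theta> i)"

definition w :: "nat \<Rightarrow> complex" where "w i = p (Suc i) - p i"

text \<open>\<open>\<phi> i m\<close> is the angle of \<open>p (i + m)\<close> seen from \<open>p i\<close>; it runs from \<open>0\<close> to \<open>2 * pi\<close> for \<open>m \<le> n\<close>.\<close>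

definition \<phi> :: "nat \<Rightarrow> nat \<Rightarrow> real" where "\<phi> i m = \<theta> (i + m) - \<theta> i"

lemma p_period [simp]: "p (i + n) = p i"
  by (simp add: p_def period cis_mult[symmetric])

lemma w_period [simp]: "w (i + n) = w i"
  using p_period[of "Suc i"] by (simp add: w_def)

lemma p_mod: "p (i mod n) = p i"
proof (induction i rule: less_induct)
  case (less i)
  show ?case
  proof (cases "i < n")
    case False
    then have "p i = p (i - n)" using p_period[of "i - n"] by simp
    then show ?thesis using less[of "i - n"] False n by (simp add: le_mod_geq)
  qed simp
qed

lemma w_mod: "w (i mod n) = w i"
proof (induction i rule: less_induct)
  case (less i)
  show ?case
  proof (cases "i < n")
    case False
    then have "w i = w (i - n)" using w_period[of "i - n"] by simp
    then show ?thesis using less[of "i - n"] False n by (simp add: le_mod_geq)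
  qed simp
qed

lemma \<phi>_less: "a < b \<Longrightarrow> \<phi> i a < \<phi> i b"
  using smono by (simp add: \<phi>_def strict_mono_less)

lemma \<phi>_le: "a \<le> b \<Longrightarrow> \<phi> i a \<le> \<phi> i b"
  using smono by (simp add: \<phi>_def strict_mono_less_eq)

lemma \<phi>_0 [simp]: "\<phi> i 0 = 0" and \<phi>_n [simp]: "\<phi> i n = 2 * pi"
  by (simp_all add: \<phi>_def period)

lemma \<phi>_bounds: "m \<le> n \<Longrightarrow> 0 \<le> \<phi> i m" "m \<le> n \<Longrightarrow> \<phi> i m \<le> 2 * pi"
  using \<phi>_le[of 0 m i] \<phi>_le[of m n i] by auto

lemma inner_p: "p i \<bullet> p (i + m) = cos (\<phi> i m)"
  by (simp add: p_def inner_cis \<phi>_def)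

lemma inner_w: "p i \<bullet> w (i + m) = cos (\<phi> i (Suc m)) - cos (\<phi> i m)"
  using inner_p[of i "Suc m"] inner_p[of i m] by (simp add: w_def inner_diff_right)

lemma inner_p_less_iff:
  "a \<le> n \<Longrightarrow> b \<le> n \<Longrightarrow> p i \<bullet> p (i + a) < p i \<bullet> p (i + b) \<longleftrightarrow> \<bar>\<phi> i a - pi\<bar> < \<bar>\<phi> i b - pi\<bar>"
  unfolding inner_p using cos_less_iff_dist_pi \<phi>_bounds by simp

lemma inner_w_neg_iff:
  "m < n \<Longrightarrow> p i \<bullet> w (i + m) < 0 \<longleftrightarrow> \<bar>\<phi> i (Suc m) - pi\<bar> < \<bar>\<phi> i m - pi\<bar>"
  unfolding inner_w using cos_less_iff_dist_pi[of "\<phi> i (Suc m)" "\<phi> i m"] \<phi>_bounds[of "Suc m" i] \<phi>_bounds[of m i]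
  by simp

lemma inner_w_pos_iff:
  "m < n \<Longrightarrow> p i \<bullet> w (i + m) > 0 \<longleftrightarrow> \<bar>\<phi> i m - pi\<bar> < \<bar>\<phi> i (Suc m) - pi\<bar>"
  unfolding inner_w using cos_less_iff_dist_pi[of "\<phi> i m" "\<phi> i (Suc m)"] \<phi>_bounds[of "Suc m" i] \<phi>_bounds[of m i]
  by simp

text \<open>For \<open>n \<ge> 2\<close> the angular gap between neighbours lies strictly between 0
  and \<open>2 * pi\<close>, so the two ends of a chord lie strictly on opposite sides of its
  bisector.\<close>

lemma inner_w_self: "p i \<bullet> w i < 0" "p (Suc i) \<bullet> w i > 0"
proof -
  have *: "\<bar>\<phi> i 1 - pi\<bar> < pi"
    using \<phi>_less[of 0 1 i] \<phi>_less[of 1 n i] n by auto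
  then show "p i \<bullet> w i < 0" using inner_w_neg_iff[of 0 i] n by simp
  have "p i \<bullet> p i = 1" "p (Suc i) \<bullet> p (Suc i) = 1" by (simp_all add: p_def inner_cis)
  then show "p (Suc i) \<bullet> w i > 0" using \<open>p i \<bullet> w i < 0\<close>
    by (simp add: w_def inner_diff_right inner_commute)
qed

lemma obtain_offset:
  assumes "i < n" "j < n" "i \<noteq> j"
  obtains k where "0 < k" "k < n" "i + k = j \<or> i + k = j + n"
proof (cases "i < j")
  case True
  then show thesis using that[of "j - i"] assms by auto
next
  case False
  then show thesis using that[of "j + n - i"] assms by auto
qed

lemma edge_less_n:
  assumes "\<forall>e<n. Q (w e)" shows "Q (w e)"
  using assms[rule_format, of "e mod n"] n by (simp add: w_mod)

text \<open>If no bisector separated \<open>p i\<close> from \<open>p j\<close>, then \<open>p j\<close> would be a local maximum of the inner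
  product with \<open>p i\<close> along the cycle, but this function has no local maximum other than \<open>p i\<close>.\<close>

lemma separated_by_edge:
  assumes "i < n" "j < n" "i \<noteq> j"
  shows "\<exists>e<n. (p i \<bullet> w e > 0) \<noteq> (p j \<bullet> w e > 0) \<or> p i \<bullet> w e = 0"
proof (rule ccontr)
  assume *: "\<not> ?thesis"
  have E: "p i \<bullet> w e \<noteq> 0 \<and> (p i \<bullet> w e > 0 \<longleftrightarrow> p j \<bullet> w e > 0)" for e
    by (rule edge_less_n) (use * in auto)
  obtain k where k: "0 < k" "k < n" "i + k = j \<or> i + k = j + n"
    using obtain_offset[OF assms] .
  obtain k' where k': "k = Suc k'" using k(1) gr0_conv_Suc by auto
  have wk: "w (i + k) = w j" "p (Suc (i + k')) = p j"
    using k(3) w_period[of j] p_period[of j] by (auto simp: k')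
  \<comment> \<open>The edge leaving \<open>p j\<close> and then the edge entering it: the signs at
    \<open>p j\<close> are known from \<open>inner_w_self\<close>, and \<open>E\<close> transfers
    them to \<open>p i\<close>.\<close>
  have "p i \<bullet> w (i + k) < 0"
    using inner_w_self(1)[of j] E[of j] by (auto simp: wk)
  moreover have "p i \<bullet> w (i + k') > 0"
    using inner_w_self(2)[of "i + k'"] E[of "i + k'"] by (simp add: wk)
  ultimately have "\<bar>\<phi> i (Suc k) - pi\<bar> < \<bar>\<phi> i k - pi\<bar>" "\<bar>\<phi> i k' - pi\<bar> < \<bar>\<phi> i k - pi\<bar>"
    using inner_w_neg_iff[of k i] inner_w_pos_iff[of k' i] k k' by auto
  moreover have "\<phi> i k' < \<phi> i k" "\<phi> i k < \<phi> i (Suc k)" using \<phi>_less k' by auto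
  \<comment> \<open>Of three increasing angles the middle one cannot be strictly farthest from
    pi.\<close>
  ultimately show False by linarith
qed

section \<open>Mutually farthest points and opposite signs\<close>

definition farthest :: "nat \<Rightarrow> nat \<Rightarrow> bool" where
  "farthest i j \<longleftrightarrow> (\<forall>c<n. c \<noteq> i \<longrightarrow> c \<noteq> j \<longrightarrow> p i \<bullet> p j < p i \<bullet> p c)"

text \<open>The opposite signs at the edges entering and leaving \<open>p j\<close> make it a strict
  local minimum of the inner product with \<open>p i\<close>; by convexity of the distance to pi it
  is then the strict global minimum.\<close>

lemma farthest_if_opposite:
  assumes ij: "i < n" "j < n" "i \<noteq> j"
    and opp: "\<forall>e<n. (p i \<bullet> w e) * (p j \<bullet> w e) < 0"
  shows "farthest i j"
  unfolding farthest_def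
proof (intro allI impI)
  fix c assume c: "c < n" "c \<noteq> i" "c \<noteq> j"
  have E: "(p i \<bullet> w e) * (p j \<bullet> w e) < 0" for e
    by (rule edge_less_n) (use opp in auto)
  obtain k where k: "0 < k" "k < n" "i + k = j \<or> i + k = j + n"
    using obtain_offset[OF ij] .
  obtain m where m: "0 < m" "m < n" "i + m = c \<or> i + m = c + n"
    using obtain_offset[OF \<open>i < n\<close> \<open>c < n\<close>] c(2) by metis
  have "m \<noteq> k" using k m c ij by auto
  obtain k' where k': "k = Suc k'" using k(1) gr0_conv_Suc by auto
  have wk: "w (i + k) = w j" "p (Suc (i + k')) = p j" "p (i + k) = p j"
    using k(3) w_period[of j] p_period[of j] by (auto simp: k')
  have "p (i + m) = p c" using m(3) p_period[of c] by auto
  have "p i \<bullet> w (i + k) > 0"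
    using inner_w_self(1)[of j] E[of j] by (simp add: wk mult_less_0_iff)
  moreover have "p i \<bullet> w (i + k') < 0"
    using inner_w_self(2)[of "i + k'"] E[of "i + k'"] by (simp add: wk mult_less_0_iff)
  ultimately have d: "\<bar>\<phi> i k - pi\<bar> < \<bar>\<phi> i (Suc k) - pi\<bar>" "\<bar>\<phi> i k - pi\<bar> < \<bar>\<phi> i k' - pi\<bar>"
    using inner_w_pos_iff[of k i] inner_w_neg_iff[of k' i] k k' by auto
  have kk: "\<phi> i k' < \<phi> i k" "\<phi> i k < \<phi> i (Suc k)" using \<phi>_less k' by auto
  have "\<bar>\<phi> i k - pi\<bar> < \<bar>\<phi> i m - pi\<bar>"
  proof (cases "m < k")
    case True
    then have "\<phi> i m \<le> \<phi> i k'" using \<phi>_le k' by simp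
    then show ?thesis using d kk by linarith
  next
    case False
    then have "\<phi> i (Suc k) \<le> \<phi> i m" using \<phi>_le \<open>m \<noteq> k\<close> by simp
    then show ?thesis using d kk by linarith
  qed
  then show "p i \<bullet> p j < p i \<bullet> p c"
    using inner_p_less_iff[of k m i] k m wk \<open>p (i + m) = p c\<close> by simp
qed

text \<open>Seen from \<open>p i\<close>, the points approach the farthest point \<open>p j\<close> monotonically on both sides.\<close>

lemma sign_if_farthest:
  assumes ij: "i < n" "j < n" and k: "0 < k" "k < n" "i + k = j \<or> i + k = j + n"
    and far: "farthest i j" and "m < n"
  shows "m < k \<Longrightarrow> p i \<bullet> w (i + m) < 0" "m \<ge> k \<Longrightarrow> p i \<bullet> w (i + m) > 0"
proof -
  have pk: "p (i + k) = p j" using k(3) p_period[of j] by auto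
  have *: "\<bar>\<phi> i k - pi\<bar> < \<bar>\<phi> i l - pi\<bar>" if "l \<le> n" "l \<noteq> k" for l
  \<comment> \<open>Offsets 0 and \<open>n\<close> both denote the point \<open>p i\<close> itself,
    which \<open>farthest\<close> does not compare; there the distance to pi has its maximal value
    pi.\<close>
  proof (cases "l = 0 \<or> l = n")
    case True
    then show ?thesis using \<phi>_less[of 0 k i] \<phi>_less[of k n i] k by auto
  next
    case False
    have "(i + l) mod n \<noteq> i" "(i + l) mod n \<noteq> j"
      using False that ij k by (auto simp: mod_if not_less split: if_splits)
    then have "p i \<bullet> p j < p i \<bullet> p (i + l)"
      using far[unfolded farthest_def, rule_format, of "(i + l) mod n"] n by (simp add: p_mod)
    then show ?thesis using inner_p_less_iff[of k l i] that k pk by simp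
  qed
  show "p i \<bullet> w (i + m) < 0" if "m < k"
  proof -
    have "\<bar>\<phi> i (Suc m) - pi\<bar> < \<bar>\<phi> i m - pi\<bar>"
    proof (cases "Suc m = k")
      case True
      then show ?thesis using *[of m] \<open>m < n\<close> by auto
    next
      case False
      \<comment> \<open>An angle that is smaller than \<open>\<phi> i k\<close> but farther from pi
        must lie below pi, so the still smaller angle \<open>\<phi> i m\<close> is farther from
        pi.\<close>
      then have "\<phi> i (Suc m) < \<phi> i k" "\<phi> i m < \<phi> i (Suc m)" using \<phi>_less that by auto
      then show ?thesis using *[of "Suc m"] False \<open>m < n\<close> by linarith
    qed
    then show ?thesis using inner_w_neg_iff \<open>m < n\<close> by simp
  qed
  show "p i \<bullet> w (i + m) > 0" if "m \<ge> k"
  proof -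
    have "\<bar>\<phi> i m - pi\<bar> < \<bar>\<phi> i (Suc m) - pi\<bar>"
    proof (cases "m = k")
      case True
      then show ?thesis using *[of "Suc m"] \<open>m < n\<close> by auto
    next
      case False
      then have "\<phi> i k < \<phi> i m" "\<phi> i m < \<phi> i (Suc m)" using \<phi>_less that by auto
      then show ?thesis using *[of m] False \<open>m < n\<close> by linarith
    qed
    then show ?thesis using inner_w_pos_iff \<open>m < n\<close> by simp
  qed
qed

text \<open>The points \<open>p i\<close> and \<open>p j\<close> split the cycle of edges into two
  runs. Seen from \<open>p i\<close>, the run towards \<open>p j\<close> is negative and the other
  one positive; seen from \<open>p j\<close>, the roles of the runs are exchanged.\<close>

lemma opposite_if_farthest:
  assumes ij: "i < n" "j < n" "i \<noteq> j" and far: "farthest i j" "farthest j i" and e: "e < n"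
  shows "(p i \<bullet> w e) * (p j \<bullet> w e) < 0"
proof -
  obtain k where k: "0 < k" "k < n" "i + k = j \<or> i + k = j + n"
    using obtain_offset[OF ij] .
  define k' where "k' = n - k"
  have k': "0 < k'" "k' < n" "j + k' = i \<or> j + k' = i + n"
    using k by (auto simp: k'_def)
  \<comment> \<open>The offset of edge \<open>e\<close> from \<open>i\<close>. Its offset
    \<open>m'\<close> from \<open>j\<close> is \<open>m - k\<close>, with a full turn of
    \<open>n\<close> added first if \<open>m < k\<close>.\<close>
  define m where "m = (if i \<le> e then e - i else e + n - i)"
  have m: "m < n" "i + m = e \<or> i + m = e + n" using e ij by (auto simp: m_def)
  then have we: "w (i + m) = w e" using w_period[of e] by auto
  show ?thesis
  proof (cases "m < k")
    case True
    define m' where "m' = m + n - k"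
    have m': "m' < n" "m' \<ge> k'" using True m k by (auto simp: m'_def k'_def)
    have "j + m' = i + m \<or> j + m' = i + m + n" using k m by (auto simp: m'_def)
    then have "w (j + m') = w e" using we w_period[of "i + m"] by auto
    then show ?thesis
      using sign_if_farthest(1)[OF ij(1,2) k far(1) m(1) True]
        sign_if_farthest(2)[OF ij(2,1) k' far(2) m'] by (simp add: we mult_neg_pos)
  next
    case False
    define m' where "m' = m - k"
    have m': "m' < n" "m' < k'" using False m k by (auto simp: m'_def k'_def)
    have "j + m' = i + m \<or> j + m' + n = i + m" using k m False by (auto simp: m'_def)
    then have "w (j + m') = w e" using we w_period[of "j + m'"] by metis
    then show ?thesis
      using sign_if_farthest(2)[OF ij(1,2) k far(1) m(1)] False
        sign_if_farthest(1)[OF ij(2,1) k' far(2) m'] by (simp add: we mult_pos_neg)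
  qed
qed


section \<open>Sign patterns of the points and the type counts\<close>

definition pat :: "nat \<Rightarrow> nat set" where "pat i = {e \<in> {..<n}. p i \<bullet> w e > 0}"

text \<open>The pairs are ordered because each unordered pair accounts for two regions of type 2,
  which are antipodal to each other.\<close>

definition mutual :: "(nat \<times> nat) set" where
  "mutual = {(i, j). i < n \<and> j < n \<and> i \<noteq> j \<and> farthest i j \<and> farthest j i}"

definition num_type :: "nat \<Rightarrow> nat" where
  "num_type k = card {A \<in> Pow {..<n}. cell w {..<n} A \<noteq> {} \<and>
     card {j. j < n \<and> p j \<in> cell w {..<n} A \<union> uminus ` cell w {..<n} A} = k}"

context
  assumes off_lines: "\<And>k e. k < n \<Longrightarrow> e < n \<Longrightarrow> p k \<bullet> w e \<noteq> 0"
    and nonparallel: "\<And>i j. i < n \<Longrightarrow> j < n \<Longrightarrow> i \<noteq> j \<Longrightarrow> (\<i> * w i) \<bullet> w j \<noteq> 0"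
begin

lemma pat_subset: "pat i \<subseteq> {..<n}"
  by (auto simp: pat_def)

lemma mem_cell_iff_pat: "i < n \<Longrightarrow> A \<subseteq> {..<n} \<Longrightarrow> p i \<in> cell w {..<n} A \<longleftrightarrow> pat i = A"
  using off_lines by (auto simp: mem_cell_iff pat_def)

lemma inj_on_pat: "inj_on pat {..<n}"
proof (rule inj_onI, rule ccontr)
  fix i j assume ij: "i \<in> {..<n}" "j \<in> {..<n}" "pat i = pat j" "i \<noteq> j"
  then obtain e where "e < n" "(p i \<bullet> w e > 0) \<noteq> (p j \<bullet> w e > 0) \<or> p i \<bullet> w e = 0"
    using separated_by_edge[of i j] by auto
  then have "(p i \<bullet> w e > 0) \<noteq> (p j \<bullet> w e > 0)" using off_lines ij by auto
  then have "(e \<in> pat i) \<noteq> (e \<in> pat j)" using \<open>e < n\<close> by (simp add: pat_def)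
  then show False using ij by simp
qed

lemma pat_complement_iff:
  assumes "i < n" "j < n"
  shows "pat j = {..<n} - pat i \<longleftrightarrow> (i, j) \<in> mutual"
proof
  assume *: "pat j = {..<n} - pat i"
  have opp: "(p i \<bullet> w e) * (p j \<bullet> w e) < 0" if "e < n" for e
  proof -
    have "e \<in> pat j \<longleftrightarrow> e \<notin> pat i" using * that by auto
    then have "p j \<bullet> w e > 0 \<longleftrightarrow> \<not> p i \<bullet> w e > 0" using that by (simp add: pat_def)
    then show ?thesis using off_lines[OF assms(1) that] off_lines[OF assms(2) that]
      by (auto simp: mult_less_0_iff not_less_iff_gr_or_eq)
  qed
  have "i \<noteq> j" using opp[of 0] n zero_le_square[of "p i \<bullet> w 0"] by (auto simp: not_less[symmetric])
  then show "(i, j) \<in> mutual"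
    using farthest_if_opposite[of i j] farthest_if_opposite[of j i] opp assms
    by (auto simp: mutual_def mult.commute)
next
  assume "(i, j) \<in> mutual"
  then have "(p i \<bullet> w e) * (p j \<bullet> w e) < 0" if "e < n" for e
    using opposite_if_farthest[of i j e] that by (auto simp: mutual_def)
  then have "e \<in> pat j \<longleftrightarrow> e \<notin> pat i" if "e < n" for e
    using that by (fastforce simp: pat_def mult_less_0_iff)
  then show "pat j = {..<n} - pat i" using pat_subset by blast
qed

text \<open>Injectivity of \<open>pat\<close> leaves at most one point per cell. As
  \<open>n > 0\<close>, a pattern differs from its complement, so the contributions of a region and
  of its antipode add up.\<close>

lemma type_eq:
  assumes "A \<subseteq> {..<n}"
  shows "card {j. j < n \<and> p j \<in> cell w {..<n} A \<union> uminus ` cell w {..<n} A}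
    = of_bool (A \<in> pat ` {..<n}) + of_bool ({..<n} - A \<in> pat ` {..<n})"
proof -
  have c: "card {j. j < n \<and> pat j = B} = of_bool (B \<in> pat ` {..<n})" for B
  proof (cases "B \<in> pat ` {..<n}")
    case True
    then obtain i where i: "i < n" "B = pat i" by auto
    then have "{j. j < n \<and> pat j = B} = {i}" using inj_on_pat by (auto simp: inj_on_def)
    then show ?thesis using True by simp
  next
    case False
    then have "{j. j < n \<and> pat j = B} = {}" by auto
    then show ?thesis using False by simp
  qed
  have "0 \<in> A \<longleftrightarrow> 0 \<notin> {..<n} - A" using n by auto
  then have "A \<noteq> {..<n} - A" by metis
  have eq: "{j. j < n \<and> p j \<in> cell w {..<n} A \<union> uminus ` cell w {..<n} A}
      = {j. j < n \<and> pat j = A} \<union> {j. j < n \<and> pat j = {..<n} - A}"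
    using assms by (auto simp: uminus_cell mem_cell_iff_pat)
  have "card ({j. j < n \<and> pat j = A} \<union> {j. j < n \<and> pat j = {..<n} - A}) = card {j. j < n \<and> pat j = A} + card {j. j < n \<and> pat j = {..<n} - A}"
    using \<open>A \<noteq> {..<n} - A\<close> by (intro card_Un_disjoint) auto
  then show ?thesis unfolding eq c .
qed

text \<open>Let \<open>R\<close> be the set of occupied patterns and \<open>R'\<close> that of their
  complements, both of size \<open>n\<close> inside a set of \<open>2 * n\<close> patterns. The
  types 2, 1 and 0 are the intersection, the symmetric difference and the complement of the union;
  the size of the intersection determines the others.\<close>

lemma num_type_values:
  "num_type 2 = card mutual" "num_type 0 = card mutual" "num_type 1 + 2 * card mutual = 2 * n"
proof -
  define I where "I = {..<n}"
  define R where "R = pat ` I"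
  define S where "S = {A \<in> Pow I. cell w I A \<noteq> {}}"
  define R' where "R' = (\<lambda>A. I - A) ` R"
  have "0 \<in> I" using n by (simp add: I_def)
  then have "I \<noteq> {}" by blast
  have "w i \<noteq> 0" for i using inner_w_self(1)[of i] by auto
  then have cS: "card S = 2 * n" unfolding S_def
    using card_cells[of I w] nonparallel \<open>I \<noteq> {}\<close> by (auto simp: I_def)
  have RS: "R \<subseteq> S"
  proof
    fix A assume "A \<in> R"
    then obtain i where i: "i < n" "A = pat i" by (auto simp: R_def I_def)
    then have "p i \<in> cell w I A" "A \<subseteq> I" using mem_cell_iff_pat pat_subset by (auto simp: I_def)
    then show "A \<in> S" by (auto simp: S_def)
  qed
  have R'S: "R' \<subseteq> S"
  proof
    fix B assume "B \<in> R'"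
    then obtain A where A: "A \<in> S" "B = I - A" using RS by (auto simp: R'_def)
    then have "cell w I B = uminus ` cell w I A" by (simp add: S_def uminus_cell)
    then show "B \<in> S" using A by (auto simp: S_def)
  qed
  have SI: "A \<subseteq> I" if "A \<in> S" for A using that by (simp add: S_def)
  have R'_iff: "A \<in> R' \<longleftrightarrow> I - A \<in> R" if "A \<in> S" for A
  proof
    assume "A \<in> R'"
    then obtain B where "B \<in> R" "A = I - B" by (auto simp: R'_def)
    then show "I - A \<in> R" using SI RS by (metis double_diff order_refl subsetD)
  next
    assume "I - A \<in> R"
    then show "A \<in> R'" using SI[OF that] unfolding R'_def by (metis double_diff image_eqI order_refl)
  qed
  have cR: "card R = n" unfolding R_def I_def using inj_on_pat by (simp add: card_image)
  have "inj_on (\<lambda>A. I - A) R" using RS SI by (intro inj_onI) blast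
  then have cR': "card R' = n" unfolding R'_def using cR by (simp add: card_image)
  have finS: "finite S" by (simp add: S_def I_def)
  then have fin: "finite R" "finite R'" using RS R'S finite_subset by auto
  have N: "card (R \<inter> R') = card mutual"
  proof -
    have "R \<inter> R' = pat ` fst ` mutual"
    proof (intro set_eqI iffI)
      fix A assume A: "A \<in> R \<inter> R'"
      then obtain i where i: "i < n" "A = pat i" by (auto simp: R_def I_def)
      have "I - A \<in> R" using A R'_iff RS by auto
      then obtain j where j: "j < n" "pat j = I - A" by (auto simp: R_def I_def)
      then have "(i, j) \<in> mutual" using pat_complement_iff i by (simp add: I_def)
      then show "A \<in> pat ` fst ` mutual" using i by force
    next
      fix A assume "A \<in> pat ` fst ` mutual"
      then obtain i j where ij: "(i, j) \<in> mutual" "A = pat i" by auto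
      then have "i < n" "j < n" by (auto simp: mutual_def)
      moreover from this have "pat j = I - A" using ij pat_complement_iff by (simp add: I_def)
      ultimately have "A \<in> R" "I - A \<in> R" using ij unfolding R_def I_def by (auto intro: image_eqI)
      then show "A \<in> R \<inter> R'" using R'_iff RS by auto
    qed
    \<comment> \<open>The partner of \<open>i\<close> is unique because its pattern is the
      complement of \<open>pat i\<close> and patterns determine points.\<close>
    moreover have "inj_on fst mutual"
    proof (rule inj_onI)
      fix x y assume xy: "x \<in> mutual" "y \<in> mutual" "fst x = fst y"
      obtain i j j' where eq: "x = (i, j)" "y = (i, j')" using xy(3) by (metis prod.collapse)
      then have lt: "i < n" "j < n" "j' < n" using xy by (auto simp: mutual_def)
      then have "pat j = pat j'" using pat_complement_iff xy eq by metis
      then show "x = y" using inj_on_pat lt eq by (auto simp: inj_on_def)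
    qed
    moreover have "inj_on pat (fst ` mutual)"
      by (rule inj_on_subset[OF inj_on_pat]) (auto simp: mutual_def)
    ultimately show ?thesis by (simp add: card_image)
  qed
  have t: "num_type k = card {A \<in> S. of_bool (A \<in> R) + of_bool (A \<in> R') = k}" for k
  proof -
    have "{A \<in> Pow {..<n}. cell w {..<n} A \<noteq> {} \<and>
      card {j. j < n \<and> p j \<in> cell w {..<n} A \<union> uminus ` cell w {..<n} A} = k}
      = {A \<in> S. card {j. j < n \<and> p j \<in> cell w {..<n} A \<union> uminus ` cell w {..<n} A} = k}"
      by (auto simp: S_def I_def)
    also have "\<dots> = {A \<in> S. of_bool (A \<in> R) + of_bool (A \<in> R') = k}"
      using type_eq SI R'_iff by (intro Collect_cong conj_cong refl) (simp add: R_def I_def)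
    finally show ?thesis by (simp add: num_type_def)
  qed
  have "{A \<in> S. of_bool (A \<in> R) + of_bool (A \<in> R') = (2::nat)} = R \<inter> R'"
    using RS by (auto simp: of_bool_def split: if_splits)
  then show two: "num_type 2 = card mutual" by (simp add: t N)
  have Un: "card (R \<union> R') + card mutual = 2 * n"
    using card_Un_Int[OF fin] cR cR' N by simp
  have "{A \<in> S. of_bool (A \<in> R) + of_bool (A \<in> R') = (0::nat)} = S - (R \<union> R')"
    by (auto simp: of_bool_def split: if_splits)
  then have "num_type 0 = card S - card (R \<union> R')"
    using fin RS R'S by (simp add: t card_Diff_subset)
  then show "num_type 0 = card mutual" using cS Un by simp
  have "{A \<in> S. of_bool (A \<in> R) + of_bool (A \<in> R') = (1::nat)} = (R \<union> R') - (R \<inter> R')"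
    using RS R'S by (auto simp: of_bool_def split: if_splits)
  moreover have "card ((R \<union> R') - (R \<inter> R')) = card (R \<union> R') - card (R \<inter> R')"
    using fin by (intro card_Diff_subset) auto
  moreover have "card (R \<inter> R') \<le> card (R \<union> R')" using fin by (intro card_mono) auto
  ultimately show "num_type 1 + 2 * card mutual = 2 * n" using Un N by (simp add: t)
qed

end

end

section \<open>Labelled configurations\<close>

lemma perp_bisector_unit:
  assumes "norm a = norm b"
  shows "perp_bisector a b = {z. z \<bullet> (b - a) = 0}"
proof -
  have "midpoint a b \<bullet> (b - a) = 0"
    using assms by (simp add: midpoint_def inner_diff_right inner_diff_left inner_add_left inner_add_right norm_eq inner_commute)
  then show ?thesis by (simp add: perp_bisector_def inner_diff_left)
qed

lemma regions_eq:
  assumes "n > 0" "\<And>i. i < n \<Longrightarrow> norm (P i) = 1"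
  shows "regions n P = components (- (\<Union>i\<in>{..<n}. {z. z \<bullet> (P (Suc i mod n) - P i) = 0}))"
  unfolding regions_def using assms by (simp add: perp_bisector_unit)

lemma cis_eq_iff_less_2pi:
  assumes "cis a = cis b" "a \<le> b" "b < a + 2 * pi"
  shows "a = b"
proof -
  have "cos (b - a) = 1"
    using arg_cong[OF assms(1), of "\<lambda>z. z \<bullet> cis b"] by (simp add: inner_cis)
  then have "cos (b - a) = cos 0" by simp
  then obtain m :: int where "b - a = 2 * pi * m"
    using cos_one_2pi_int[of "b - a"] by (auto simp: mult_ac)
  then have m: "b = a + 2 * pi * m" by simp
  then have "0 \<le> m" "m < 1" using assms(2,3) pi_gt_zero
    by (simp_all add: zero_le_mult_iff)
  then have "m = 0" by linarith
  then show ?thesis using m by simp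
qed

text \<open>Integrating \<open>H\<close> requires measurability, for which a formula at almost every
  outcome does not suffice. This covers the outcomes at which points coincide.\<close>

lemma H_collision:
  assumes lab: "ccw_labelling n x P" and ninj: "\<not> inj_on x {..<n}"
  shows "H k n P = 0"
proof -
  obtain \<sigma> \<theta> where \<sigma>: "bij_betw \<sigma> {..<n} {..<n}"
    and P: "\<And>i. i < n \<Longrightarrow> P i = x (\<sigma> i)" "\<And>i. i < n \<Longrightarrow> P i = cis (\<theta> i)"
    and mono: "\<And>i j. i \<le> j \<Longrightarrow> j < n \<Longrightarrow> \<theta> i \<le> \<theta> j"
    and le: "\<And>i. i < n \<Longrightarrow> \<theta> i \<le> \<theta> 0 + 2 * pi"
    using lab unfolding ccw_labelling_def by blast
  have "\<not> inj_on P {..<n}"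
  proof
    assume "inj_on P {..<n}"
    then have "inj_on (x \<circ> \<sigma>) {..<n}" using P(1) by (simp add: inj_on_def)
    then show False using ninj \<sigma> by (metis bij_betw_def comp_inj_on_iff)
  qed
  then obtain a b where "a < n" "b < n" "a \<noteq> b" "P a = P b" by (auto simp: inj_on_def)
  then obtain a b where ab: "a < b" "b < n" "P a = P b" by (metis nat_neq_iff)
  have "\<exists>i<n. P i = P (Suc i mod n)"
  \<comment> \<open>Less than a turn apart, equal points have equal angles, and monotonicity
    squeezes the neighbour of \<open>a\<close> onto \<open>a\<close>. A full turn apart, the last
    and the first label coincide.\<close>
  proof (cases "\<theta> b < \<theta> a + 2 * pi")
    case True
    then have "\<theta> a = \<theta> b"
      using cis_eq_iff_less_2pi[of "\<theta> a" "\<theta> b"] P(2) ab mono[of a b] by simp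
    then have "\<theta> (Suc a) = \<theta> a" using mono[of a "Suc a"] mono[of "Suc a" b] ab by simp
    then show ?thesis using P(2) ab by (intro exI[of _ a]) simp
  next
    case False
    then have "\<theta> b = \<theta> 0 + 2 * pi" using le[of b] mono[of 0 a] ab by simp
    then have "\<theta> (n - 1) = \<theta> 0 + 2 * pi" using mono[of b "n - 1"] le[of "n - 1"] ab by simp
    then have "P (n - 1) = P 0" using P(2) ab by (simp add: cis_mult[symmetric])
    then show ?thesis using ab by (intro exI[of _ "n - 1"]) simp
  qed
  then obtain i where i: "i < n" "P i = P (Suc i mod n)" by blast
  then have "perp_bisector (P i) (P (Suc i mod n)) = UNIV" by (simp add: perp_bisector_def)
  then have "- (\<Union>i<n. perp_bisector (P i) (P (Suc i mod n))) = {}" using i by blast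
  then have "regions n P = {}" by (simp add: regions_def)
  then show ?thesis by (simp add: H_def)
qed

text \<open>Distinctness sharpens the weak inequalities of the labelling to strict ones, including
  the one from the last point to the first a turn later; then each lap adds
  \<open>2 * pi\<close>.\<close>

lemma labelling_cycle:
  assumes lab: "ccw_labelling n x P" and inj: "inj_on x {..<n}" and n: "n \<ge> 2"
  obtains \<sigma> \<theta> where "bij_betw \<sigma> {..<n} {..<n}" "ccw_cycle n \<theta>"
    "\<And>i. i < n \<Longrightarrow> P i = x (\<sigma> i)" "\<And>i. i < n \<Longrightarrow> P i = cis (\<theta> i)"
proof -
  obtain \<sigma> \<theta> where \<sigma>: "bij_betw \<sigma> {..<n} {..<n}"
    and P: "\<And>i. i < n \<Longrightarrow> P i = x (\<sigma> i)" "\<And>i. i < n \<Longrightarrow> P i = cis (\<theta> i)"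
    and mono: "\<And>i j. i \<le> j \<Longrightarrow> j < n \<Longrightarrow> \<theta> i \<le> \<theta> j"
    and le: "\<And>i. i < n \<Longrightarrow> \<theta> i \<le> \<theta> 0 + 2 * pi"
    using lab unfolding ccw_labelling_def by blast
  have injP: "P i \<noteq> P j" if "i < n" "j < n" "i \<noteq> j" for i j
    using inj \<sigma> that P(1) by (metis bij_betw_def bij_betw_apply inj_onD lessThan_iff)
  have step: "\<theta> i < \<theta> (Suc i)" if "Suc i < n" for i
    using mono[of i "Suc i"] injP[of i "Suc i"] P(2) that by (cases "\<theta> i = \<theta> (Suc i)") auto
  have last: "\<theta> (n - 1) < \<theta> 0 + 2 * pi"
  proof (rule ccontr)
    assume "\<not> ?thesis"
    then have "\<theta> (n - 1) = \<theta> 0 + 2 * pi" using le[of "n - 1"] n by simp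
    then have "P (n - 1) = P 0" using P(2) n by (simp add: cis_mult[symmetric])
    then show False using injP[of "n - 1" 0] n by simp
  qed
  define \<theta>' where "\<theta>' i = \<theta> (i mod n) + 2 * pi * real (i div n)" for i
  have "\<theta>' i < \<theta>' (Suc i)" for i
  proof (cases "Suc (i mod n) = n")
    case True
    then have "Suc i mod n = 0" "Suc i div n = Suc (i div n)"
      by (simp_all add: mod_Suc div_Suc)
    moreover have "i mod n = n - 1" using True by simp
    ultimately show ?thesis using last by (simp add: \<theta>'_def algebra_simps)
  next
    case False
    then have "Suc i mod n = Suc (i mod n)" "Suc i div n = i div n"
      by (simp_all add: mod_Suc div_Suc)
    moreover have "Suc (i mod n) < n" using False n mod_less_divisor[of n i] by linarith
    ultimately show ?thesis using step by (simp add: \<theta>'_def)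
  qed
  then have "strict_mono \<theta>'" by (simp add: strict_mono_Suc_iff)
  moreover have "\<theta>' (i + n) = \<theta>' i + 2 * pi" for i
    using n by (simp add: \<theta>'_def algebra_simps)
  ultimately have "ccw_cycle n \<theta>'" using n by unfold_locales auto
  moreover have "\<theta>' i = \<theta> i" if "i < n" for i using that by (simp add: \<theta>'_def)
  ultimately show thesis using that[OF \<sigma>, of \<theta>'] P by simp
qed

section \<open>Cyclic neighbours recognised by orientation\<close>

definition orient :: "complex \<Rightarrow> complex \<Rightarrow> complex \<Rightarrow> real" where
  "orient a b c = Im (cnj (b - a) * (c - a))"

text \<open>\<open>orient\<close> is twice the signed area of the triangle. With half-gaps
  \<open>u\<close> and \<open>v\<close> the formula is \<open>sin (2 * u) + sin (2 * v) - sin (2 *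
  (u + v)) = 4 * sin u * sin v * sin (u + v)\<close>, whose right side exhibits the sign.\<close>

lemma orient_cis:
  "orient (cis a) (cis b) (cis c) = 4 * sin ((b - a) / 2) * sin ((c - b) / 2) * sin ((c - a) / 2)"
proof -
  define u v where "u = (b - a) / 2" and "v = (c - b) / 2"
  have b: "b = a + 2 * u" and c: "c = a + 2 * u + 2 * v" by (simp_all add: u_def v_def field_simps)
  have "orient (cis a) (cis b) (cis c) = sin (c - b) + sin (b - a) - sin (c - a)"
    by (simp add: orient_def sin_diff algebra_simps)
  also have "\<dots> = sin (2 * v) + sin (2 * u) - sin (2 * (u + v))"
    by (simp add: b c)
  also have "\<dots> = 4 * sin u * sin v * sin (u + v)"
    unfolding sin_double sin_add cos_add
    using sin_cos_squared_add[of u] sin_cos_squared_add[of v] by algebra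
  finally show ?thesis by (simp add: u_def v_def add_divide_distrib[symmetric])
qed

text \<open>A description of the cyclic neighbours that does not refer to a labelling. It makes the
  number of regions of each type a measurable function of the points, although the labelling \<open>P\<close> may
  depend on the outcome in a non-measurable way.\<close>

definition succ_pairs :: "nat \<Rightarrow> (nat \<Rightarrow> complex) \<Rightarrow> (nat \<times> nat) set" where
  "succ_pairs n x = {(a, b) \<in> {..<n} \<times> {..<n}. a \<noteq> b \<and>
     (\<forall>c<n. c \<noteq> a \<longrightarrow> c \<noteq> b \<longrightarrow> orient (x a) (x b) (x c) > 0)}"

context ccw_cycle
begin

lemma orient_pos:
  assumes "a < b" "b < c" "c < a + n"
  shows "orient (p a) (p b) (p c) > 0"
proof -
  have "\<theta> a < \<theta> b" "\<theta> b < \<theta> c" "\<theta> c < \<theta> a + 2 * pi"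
    using assms strict_monoD[OF smono] by (auto simp: period[symmetric])
  then have "sin ((\<theta> b - \<theta> a) / 2) > 0" "sin ((\<theta> c - \<theta> b) / 2) > 0" "sin ((\<theta> c - \<theta> a) / 2) > 0"
    by (auto intro!: sin_gt_zero)
  then show ?thesis by (simp add: p_def orient_cis)
qed

lemma orient_swap: "orient a c b = - orient a b c"
  by (simp add: orient_def algebra_simps)

text \<open>If \<open>b\<close> is the successor of \<open>a\<close>, all other points lie to the
  left of the chord from \<open>a\<close> to \<open>b\<close>. If it is not, the true successor of
  \<open>a\<close> lies to the right, contradicting the antisymmetry of
  \<open>orient\<close>.\<close>

lemma succ_pairs_eq:
  assumes \<sigma>: "bij_betw \<sigma> {..<n} {..<n}" and x: "\<And>i. i < n \<Longrightarrow> x (\<sigma> i) = p i"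
  shows "succ_pairs n x = (\<lambda>i. (\<sigma> i, \<sigma> (Suc i mod n))) ` {..<n}"
proof -
  have \<sigma>_less: "\<sigma> i < n" if "i < n" for i using \<sigma> that by (auto dest: bij_betw_apply)
  have \<sigma>_inj: "\<sigma> i = \<sigma> j \<longleftrightarrow> i = j" if "i < n" "j < n" for i j
    using \<sigma> that by (auto simp: bij_betw_def inj_on_def)
  have \<sigma>_surj: "\<exists>i<n. \<sigma> i = a" if "a < n" for a
    using \<sigma> that by (metis bij_betw_iff_bijections lessThan_iff)
  have pp: "p (i + k) = p j" if "i + k = j \<or> i + k = j + n" for i j k using that p_period[of j] by auto
  have "(\<sigma> i, \<sigma> (Suc i mod n)) \<in> succ_pairs n x" if "i < n" for i
  proof -
    have Suc: "Suc i mod n < n" "Suc i mod n \<noteq> i" using n that by (auto simp: mod_Suc)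
    have "orient (x (\<sigma> i)) (x (\<sigma> (Suc i mod n))) (x c) > 0"
      if c: "c < n" "c \<noteq> \<sigma> i" "c \<noteq> \<sigma> (Suc i mod n)" for c
    proof -
      obtain j where j: "j < n" "\<sigma> j = c" using \<sigma>_surj c by blast
      then have "i \<noteq> j" using c by auto
      obtain k where k: "0 < k" "k < n" "i + k = j \<or> i + k = j + n"
        using obtain_offset[OF \<open>i < n\<close> j(1) \<open>i \<noteq> j\<close>] .
      have "k \<noteq> 1"
      proof
        assume "k = 1"
        then have "Suc i mod n = j" using k(3) j(1) by (metis Suc_eq_plus1 mod_add_self2 mod_less)
        then show False using c(3) j(2) by simp
      qed
      then have "orient (p i) (p (Suc i)) (p (i + k)) > 0"
        using k by (intro orient_pos) auto
      then show ?thesis using x[OF \<open>i < n\<close>] x[OF Suc(1)] x[OF j(1)] j(2) pp[OF k(3)] by (simp add: p_mod)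
    qed
    then show ?thesis using \<sigma>_less \<sigma>_inj Suc that by (auto simp: succ_pairs_def)
  qed
  moreover have "(a, b) \<in> (\<lambda>i. (\<sigma> i, \<sigma> (Suc i mod n))) ` {..<n}" if ab: "(a, b) \<in> succ_pairs n x" for a b
  proof -
    have "a < n" "b < n" "a \<noteq> b" using ab by (auto simp: succ_pairs_def)
    then obtain i j where ij: "i < n" "\<sigma> i = a" "j < n" "\<sigma> j = b" "i \<noteq> j" using \<sigma>_surj by metis
    obtain k where k: "0 < k" "k < n" "i + k = j \<or> i + k = j + n"
      using obtain_offset[OF ij(1,3,5)] .
    have "k = 1"
    proof (rule ccontr)
      assume "k \<noteq> 1"
      then have pos: "orient (p i) (p (Suc i)) (p (i + k)) > 0"
        using k by (intro orient_pos) auto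
      define c where "c = Suc i mod n"
      have c: "c < n" "c \<noteq> i" "c \<noteq> j" using n ij k \<open>k \<noteq> 1\<close> by (auto simp: c_def mod_Suc split: if_splits)
      then have "orient (x a) (x b) (x (\<sigma> c)) > 0"
        using ab \<sigma>_less[OF c(1)] \<sigma>_inj ij by (auto simp: succ_pairs_def)
      then have "orient (p i) (p (i + k)) (p (Suc i)) > 0"
        using x[OF ij(1)] x[OF ij(3)] x[OF c(1)] ij pp[OF k(3)] by (simp add: c_def p_mod)
      then show False using pos orient_swap[of "p i" "p (i + k)" "p (Suc i)"] by simp
    qed
    then have "j = Suc i mod n" using k ij by (auto simp: mod_Suc)
    then show ?thesis using ij by auto
  qed
  ultimately show ?thesis by auto
qed

end

definition edge_vec :: "(nat \<Rightarrow> complex) \<Rightarrow> nat \<times> nat \<Rightarrow> complex" where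
  "edge_vec x = (\<lambda>(a, b). x b - x a)"

lemma card_labels:
  assumes "bij_betw \<sigma> {..<n} {..<n}" "\<And>i. i < n \<Longrightarrow> P i = x (\<sigma> i)"
  shows "card {j. j < n \<and> P j \<in> T} = card {j. j < n \<and> x j \<in> T}"
proof (rule bij_betw_same_card[of \<sigma>])
  show "bij_betw \<sigma> {j. j < n \<and> P j \<in> T} {j. j < n \<and> x j \<in> T}"
    using assms unfolding bij_betw_iff_bijections by (smt (verit) lessThan_iff mem_Collect_eq)
qed

text \<open>The right side mentions only the points \<open>x\<close>, so \<open>H\<close> does not
  depend on the choice among the possible labellings.\<close>

lemma H_succ_pairs:
  assumes lab: "ccw_labelling n x P" and inj: "inj_on x {..<n}" and n: "n \<ge> 2"
  shows "H k n P = card {A \<in> Pow (succ_pairs n x). cell (edge_vec x) (succ_pairs n x) A \<noteq> {} \<and>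
    card {j. j < n \<and> x j \<in> cell (edge_vec x) (succ_pairs n x) A
      \<union> uminus ` cell (edge_vec x) (succ_pairs n x) A} = k}"
proof -
  obtain \<sigma> \<theta> where \<sigma>: "bij_betw \<sigma> {..<n} {..<n}" and cyc: "ccw_cycle n \<theta>"
    and P: "\<And>i. i < n \<Longrightarrow> P i = x (\<sigma> i)" "\<And>i. i < n \<Longrightarrow> P i = cis (\<theta> i)"
    using labelling_cycle[OF assms] by metis
  interpret ccw_cycle n \<theta> by (rule cyc)
  have E: "succ_pairs n x = (\<lambda>i. (\<sigma> i, \<sigma> (Suc i mod n))) ` {..<n}"
    by (rule succ_pairs_eq[OF \<sigma>]) (use P in \<open>simp add: p_def\<close>)
  have "regions n P = components (- (\<Union>i\<in>{..<n}. {z. z \<bullet> (P (Suc i mod n) - P i) = 0}))"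
    using n by (intro regions_eq) (simp_all add: P(2))
  also have "(\<Union>i\<in>{..<n}. {z. z \<bullet> (P (Suc i mod n) - P i) = 0})
    = (\<Union>e\<in>succ_pairs n x. {z. z \<bullet> edge_vec x e = 0})"
    unfolding E using P(1) n by (auto simp: edge_vec_def)
  finally have R: "regions n P = components (- (\<Union>e\<in>succ_pairs n x. {z. z \<bullet> edge_vec x e = 0}))" .
  have "card {j. j < n \<and> P j \<in> T} = card {j. j < n \<and> x j \<in> T}" for T
    by (rule card_labels[OF \<sigma>]) (rule P(1))
  then show ?thesis
    unfolding H_def R region_type_def card_components_cells by (simp only:)
qed

section \<open>Generic position on the unit circle\<close>

lemma cnj_unit:
  assumes "norm z = 1" shows "cnj z = 1 / z"
  using assms complex_norm_square[of z] by (cases "z = 0") (auto simp: field_simps)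

text \<open>For unit vectors \<open>2 * (u \<bullet> z) = z / u + u / z\<close>, and the difference
  of the two values factors. The second alternative says that \<open>a\<close> and \<open>b\<close>
  are mirror images in the line through 0 and \<open>u\<close>.\<close>

lemma inner_unit_eq:
  fixes u a b :: complex
  assumes "norm u = 1" "norm a = 1" "norm b = 1" "u \<bullet> a = u \<bullet> b"
  shows "a = b \<or> u * u = a * b"
proof -
  have nz: "u \<noteq> 0" "a \<noteq> 0" "b \<noteq> 0" using assms by auto
  have i: "complex_of_real (2 * (u \<bullet> z)) = z / u + u / z" if "norm z = 1" for z
  proof -
    have "cnj u * z + u * cnj z = complex_of_real (2 * (u \<bullet> z))"
      by (simp add: complex_eq_iff inner_complex_def)
    moreover have "cnj u = 1 / u" "cnj z = 1 / z"
      using that assms(1) by (simp_all add: cnj_unit)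
    ultimately show ?thesis by (simp add: mult_ac)
  qed
  have "a / u + u / a = b / u + u / b" using i[OF assms(2)] i[OF assms(3)] assms(4) by simp
  then have "(a - b) * (a * b - u * u) = 0" using nz by (simp add: field_simps) algebra
  then show ?thesis by auto
qed

text \<open>The hypothesis says that the chords are parallel. Replacing conjugates by inverses
  yields a factorisation: the direction of a chord is determined by the product of its
  endpoints.\<close>

lemma parallel_chords:
  fixes a b c d :: complex
  assumes "norm a = 1" "norm b = 1" "norm c = 1" "norm d = 1" "(\<i> * (b - a)) \<bullet> (d - c) = 0"
  shows "a = b \<or> c = d \<or> a * b = c * d"
proof -
  have nz: "a \<noteq> 0" "b \<noteq> 0" "c \<noteq> 0" "d \<noteq> 0" using assms by auto
  have "cnj (b - a) * (d - c) = (b - a) * cnj (d - c)"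
    using assms(5) by (simp add: complex_eq_iff inner_complex_def algebra_simps)
  then have "(1 / b - 1 / a) * (d - c) = (b - a) * (1 / d - 1 / c)"
    using assms(1-4) by (simp add: cnj_unit)
  then have "(a - b) * (d - c) * (c * d - a * b) = 0" using nz by (simp add: field_simps) algebra
  then show ?thesis by auto
qed

text \<open>The indices \<open>a\<close>, \<open>b\<close>, \<open>c\<close> may coincide: the condition contains that the points are distinct,
  that no point lies on a bisector of two others, and that no two different chords are parallel.\<close>

definition generic :: "nat \<Rightarrow> (nat \<Rightarrow> complex) \<Rightarrow> bool" where
  "generic n x \<longleftrightarrow>
     (\<forall>a<n. \<forall>b<n. \<forall>c<n. \<forall>d<n. d \<noteq> a \<longrightarrow> d \<noteq> b \<longrightarrow> d \<noteq> c \<longrightarrow> x d * x c \<noteq> x a * x b)"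

definition farthest_pair :: "nat \<Rightarrow> (nat \<Rightarrow> complex) \<Rightarrow> nat \<Rightarrow> nat \<Rightarrow> bool" where
  "farthest_pair n x a b \<longleftrightarrow>
     (\<forall>c<n. c \<noteq> a \<longrightarrow> c \<noteq> b \<longrightarrow> x a \<bullet> x b < x a \<bullet> x c \<and> x a \<bullet> x b < x b \<bullet> x c)"

definition farthest_pairs :: "nat \<Rightarrow> (nat \<Rightarrow> complex) \<Rightarrow> (nat \<times> nat) set" where
  "farthest_pairs n x = {(a, b) \<in> {..<n} \<times> {..<n}. a \<noteq> b \<and> farthest_pair n x a b}"

text \<open>Genericity supplies both assumptions of the count: a point on a bisector would give
  \<open>p k * p k = p e * p (Suc e)\<close>, and coinciding bisectors would belong to parallel
  chords. The permutation \<open>\<sigma>\<close> then carries mutual pairs to the original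
  numbering.\<close>

lemma H_generic:
  assumes lab: "ccw_labelling n x P" and gen: "generic n x" and n3: "n \<ge> 3"
  shows "H 2 n P = card (farthest_pairs n x)" "H 0 n P = card (farthest_pairs n x)"
    "H 1 n P + 2 * card (farthest_pairs n x) = 2 * n"
proof -
  have inj: "inj_on x {..<n}"
  proof (rule inj_onI, rule ccontr)
    fix a d assume "a \<in> {..<n}" "d \<in> {..<n}" "x a = x d" "a \<noteq> d"
    then show False using gen[unfolded generic_def, rule_format, of a a a d] by auto
  qed
  have "n \<ge> 2" using n3 by simp
  obtain \<sigma> \<theta> where \<sigma>: "bij_betw \<sigma> {..<n} {..<n}" and cyc: "ccw_cycle n \<theta>"
    and P: "\<And>i. i < n \<Longrightarrow> P i = x (\<sigma> i)" "\<And>i. i < n \<Longrightarrow> P i = cis (\<theta> i)"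
    using labelling_cycle[OF lab inj \<open>n \<ge> 2\<close>] by metis
  interpret ccw_cycle n \<theta> by (rule cyc)
  have Pp: "P i = p i" if "i < n" for i using P(2) that by (simp add: p_def)
  have \<sigma>_less: "\<sigma> i < n" if "i < n" for i using \<sigma> that by (auto dest: bij_betw_apply)
  have \<sigma>_inj: "\<sigma> i = \<sigma> j \<longleftrightarrow> i = j" if "i < n" "j < n" for i j
    using \<sigma> that by (auto simp: bij_betw_def inj_on_def)
  have \<sigma>_surj: "\<exists>i<n. \<sigma> i = a" if "a < n" for a
    using \<sigma> that by (metis bij_betw_iff_bijections lessThan_iff)
  have genp: "p d * p c \<noteq> p a * p b"
    if "a < n" "b < n" "c < n" "d < n" "d \<noteq> a" "d \<noteq> b" "d \<noteq> c" for a b c d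
    using gen[unfolded generic_def, rule_format, of "\<sigma> a" "\<sigma> b" "\<sigma> c" "\<sigma> d"] that
    by (simp add: \<sigma>_less \<sigma>_inj P(1)[symmetric] Pp)
  have np: "norm (p i) = 1" for i by (simp add: p_def)
  have Sn: "Suc i mod n < n" "Suc i mod n \<noteq> i" if "i < n" for i using n that by (auto simp: mod_Suc)
  have wmod: "w i = p (Suc i mod n) - p i" for i by (simp add: w_def p_mod)
  have w_nz: "w i \<noteq> 0" for i using inner_w_self(1)[of i] by auto
  have off: "p k \<bullet> w e \<noteq> 0" if "k < n" "e < n" for k e
  proof
    assume *: "p k \<bullet> w e = 0"
    show False
    proof (cases "k = e \<or> k = Suc e mod n")
      case True
      then have "p k = p e \<or> p k = p (Suc e)" by (auto simp: p_mod)
      then show False using * inner_w_self[of e] by auto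
    next
      case False
      have "p k \<bullet> p e = p k \<bullet> p (Suc e mod n)" using * by (simp add: wmod inner_diff_right)
      then have "p e = p (Suc e mod n) \<or> p k * p k = p e * p (Suc e mod n)"
        using inner_unit_eq np by blast
      then show False using w_nz[of e] genp[of k k e "Suc e mod n"] False Sn that
        by (auto simp: wmod mult.commute)
    qed
  qed
  have nonpar: "(\<i> * w i) \<bullet> w j \<noteq> 0" if "i < n" "j < n" "i \<noteq> j" for i j
  proof
    assume "(\<i> * w i) \<bullet> w j = 0"
    then have eq: "p i * p (Suc i mod n) = p j * p (Suc j mod n)"
      using parallel_chords[OF np np np np, of "Suc i mod n" i "Suc j mod n" j] w_nz[of i] w_nz[of j]
      by (auto simp: wmod)
    show False
    \<comment> \<open>Genericity needs one index different from the other three. This is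
      \<open>i\<close>, unless the edge \<open>i\<close> starts where the edge \<open>j\<close>
      ends; then it is the far end of edge \<open>i\<close>, which differs from \<open>j\<close>
      because \<open>n \<ge> 3\<close>.\<close>
    proof (cases "i = Suc j mod n")
      case False
      then show False
        using genp[of j "Suc j mod n" "Suc i mod n" i] eq Sn[of i] Sn[of j] that by auto
    next
      case True
      have "Suc i mod n \<noteq> j" using True n3 that by (auto simp: mod_Suc split: if_splits)
      then show False
        using genp[of j "Suc j mod n" i "Suc i mod n"] eq Sn[of i] Sn[of j] that True
        by (auto simp: mult.commute)
    qed
  qed
  have H: "H k n P = num_type k" for k
  proof -
    have "regions n P = components (- (\<Union>i\<in>{..<n}. {z. z \<bullet> (P (Suc i mod n) - P i) = 0}))"
      using n by (intro regions_eq) (simp_all add: P(2))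
    also have "(\<Union>i\<in>{..<n}. {z. z \<bullet> (P (Suc i mod n) - P i) = 0}) = (\<Union>i\<in>{..<n}. {z. z \<bullet> w i = 0})"
      using Pp Sn by (auto simp: wmod)
    finally have R: "regions n P = components (- (\<Union>i\<in>{..<n}. {z. z \<bullet> w i = 0}))" .
    have "card {j. j < n \<and> P j \<in> T} = card {j. j < n \<and> p j \<in> T}" for T
      using Pp by (metis (no_types, lifting))
    then show ?thesis
      unfolding H_def R region_type_def card_components_cells num_type_def by (simp only:)
  qed
  have "card mutual = card (farthest_pairs n x)"
  proof (rule bij_betw_same_card)
    have "(\<lambda>(i, j). (\<sigma> i, \<sigma> j)) ` mutual = farthest_pairs n x"
    proof -
      have m: "(i, j) \<in> mutual \<longleftrightarrow> (\<sigma> i, \<sigma> j) \<in> farthest_pairs n x" if ij: "i < n" "j < n" for i j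
      proof -
        have xp: "x (\<sigma> c) = p c" if "c < n" for c using P(1) Pp that by simp
        have all: "(\<forall>c<n. Q c) \<longleftrightarrow> (\<forall>c<n. Q (\<sigma> c))" for Q using \<sigma>_surj \<sigma>_less by metis
        have "farthest_pair n x (\<sigma> i) (\<sigma> j) \<longleftrightarrow>
          (\<forall>c<n. \<sigma> c \<noteq> \<sigma> i \<longrightarrow> \<sigma> c \<noteq> \<sigma> j \<longrightarrow> x (\<sigma> i) \<bullet> x (\<sigma> j) < x (\<sigma> i) \<bullet> x (\<sigma> c) \<and>
            x (\<sigma> i) \<bullet> x (\<sigma> j) < x (\<sigma> j) \<bullet> x (\<sigma> c))"
          unfolding farthest_pair_def by (rule all)
        also have "\<dots> \<longleftrightarrow> farthest i j \<and> farthest j i"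
          unfolding farthest_def using ij xp \<sigma>_inj by (auto simp: inner_commute)
        finally show ?thesis
          using ij \<sigma>_inj \<sigma>_less by (simp add: farthest_pairs_def mutual_def)
      qed
      show ?thesis
      proof (intro set_eqI iffI)
        fix y assume "y \<in> (\<lambda>(i, j). (\<sigma> i, \<sigma> j)) ` mutual"
        then obtain i j where "y = (\<sigma> i, \<sigma> j)" "(i, j) \<in> mutual" by auto
        then show "y \<in> farthest_pairs n x" using m[of i j] by (simp add: mutual_def)
      next
        fix y assume y: "y \<in> farthest_pairs n x"
        then have "fst y < n" "snd y < n" by (auto simp: farthest_pairs_def)
        then obtain i j where ij: "i < n" "j < n" "y = (\<sigma> i, \<sigma> j)" using \<sigma>_surj by (metis prod.collapse)
        then have "(i, j) \<in> mutual" using m y by simp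
        then show "y \<in> (\<lambda>(i, j). (\<sigma> i, \<sigma> j)) ` mutual" using ij by force
      qed
    qed
    moreover have "inj_on (\<lambda>(i, j). (\<sigma> i, \<sigma> j)) mutual"
      by (auto simp: inj_on_def mutual_def \<sigma>_inj)
    ultimately show "bij_betw (\<lambda>(i, j). (\<sigma> i, \<sigma> j)) mutual (farthest_pairs n x)"
      by (simp add: bij_betw_def)
  qed
  then show "H 2 n P = card (farthest_pairs n x)" "H 0 n P = card (farthest_pairs n x)"
    "H 1 n P + 2 * card (farthest_pairs n x) = 2 * n"
    using num_type_values[OF off nonpar] by (simp_all add: H)
qed

section \<open>Measurability\<close>

lemma measurable_card_Collect:
  assumes "finite I" "\<And>i. i \<in> I \<Longrightarrow> Measurable.pred M (Q i)"
  shows "(\<lambda>\<omega>. card {i \<in> I. Q i \<omega>}) \<in> measurable M (count_space UNIV)"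
  using assms
proof (induction I rule: finite_induct)
  case (insert a I)
  have [measurable]: "(\<lambda>\<omega>. card {i \<in> I. Q i \<omega>}) \<in> measurable M (count_space UNIV)" "Measurable.pred M (Q a)"
    using insert by auto
  have "{i \<in> insert a I. Q i \<omega>} = (if Q a \<omega> then insert a {i \<in> I. Q i \<omega>} else {i \<in> I. Q i \<omega>})" for \<omega>
    by auto
  then have "card {i \<in> insert a I. Q i \<omega>} = (if Q a \<omega> then Suc (card {i \<in> I. Q i \<omega>}) else card {i \<in> I. Q i \<omega>})" for \<omega>
    using insert(1,2) by (simp add: card_insert_if)
  then show ?case by simp
qed simp

lemma pred_mem_cell:
  fixes z :: "'a \<Rightarrow> complex"
  assumes [measurable]: "z \<in> borel_measurable M" "\<And>i. i \<in> I \<Longrightarrow> (\<lambda>\<omega>. w \<omega> i) \<in> borel_measurable M" and "finite I"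
  shows "Measurable.pred M (\<lambda>\<omega>. z \<omega> \<in> cell (w \<omega>) I A)"
proof -
  have "Measurable.pred M (\<lambda>\<omega>. if i \<in> A then z \<omega> \<bullet> w \<omega> i > 0 else z \<omega> \<bullet> w \<omega> i < 0)" if "i \<in> I" for i
    using assms(2)[OF that] by (cases "i \<in> A") simp_all
  then show ?thesis
    unfolding cell_def mem_Collect_eq using \<open>finite I\<close> by (intro pred_intros_finite(3)) auto
qed

text \<open>Cells are open, so it suffices to look for points of a countable dense set.\<close>

lemma pred_cell_nonempty:
  fixes w :: "'a \<Rightarrow> 'i \<Rightarrow> complex"
  assumes "\<And>i. i \<in> I \<Longrightarrow> (\<lambda>\<omega>. w \<omega> i) \<in> borel_measurable M" and "finite I"
  shows "Measurable.pred M (\<lambda>\<omega>. cell (w \<omega>) I A \<noteq> {})"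
proof -
  obtain D :: "complex set" where D: "countable D" "\<And>X. open X \<Longrightarrow> X \<noteq> {} \<Longrightarrow> \<exists>d\<in>D. d \<in> X"
    using countable_dense_setE by blast
  then have "cell (w \<omega>) I A \<noteq> {} \<longleftrightarrow> (\<exists>d\<in>D. d \<in> cell (w \<omega>) I A)" for \<omega>
    using cell_open[OF \<open>finite I\<close>, of "w \<omega>" A] by auto
  moreover have "{\<omega> \<in> space M. \<exists>d\<in>D. d \<in> cell (w \<omega>) I A} \<in> sets M"
  proof -
    have "{\<omega> \<in> space M. d \<in> cell (w \<omega>) I A} \<in> sets M" for d
      using pred_mem_cell[of "\<lambda>_. d" M I w A] assms by (simp add: pred_def)
    then have "(\<Union>d\<in>D. {\<omega> \<in> space M. d \<in> cell (w \<omega>) I A}) \<in> sets M"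
      by (intro sets.countable_UN'' D(1))
    moreover have "(\<Union>d\<in>D. {\<omega> \<in> space M. d \<in> cell (w \<omega>) I A}) = {\<omega> \<in> space M. \<exists>d\<in>D. d \<in> cell (w \<omega>) I A}"
      by auto
    ultimately show ?thesis by simp
  qed
  then have "Measurable.pred M (\<lambda>\<omega>. \<exists>d\<in>D. d \<in> cell (w \<omega>) I A)" by (simp add: pred_def)
  ultimately show ?thesis by simp
qed

lemma measurable_succ_pairs:
  assumes [measurable]: "\<And>i. i < n \<Longrightarrow> X i \<in> borel_measurable M"
  shows "(\<lambda>\<omega>. succ_pairs n (\<lambda>i. X i \<omega>)) \<in> measurable M (count_space (Pow ({..<n} \<times> {..<n})))"
proof -
  have A: "Measurable.pred M (\<lambda>\<omega>. (a, b) \<in> succ_pairs n (\<lambda>i. X i \<omega>))" if "a < n" "b < n" for a b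
  proof -
    have A: "Measurable.pred M (\<lambda>\<omega>. \<forall>c\<in>{..<n}. c \<noteq> a \<longrightarrow> c \<noteq> b \<longrightarrow> orient (X a \<omega>) (X b \<omega>) (X c \<omega>) > 0)"
    proof (rule pred_intros_finite(3))
      fix c assume "c \<in> {..<n}"
      then have [measurable]: "X a \<in> borel_measurable M" "X b \<in> borel_measurable M" "X c \<in> borel_measurable M"
        using that by auto
      have "orient x y z = (Re y - Re x) * (Im z - Im x) - (Im y - Im x) * (Re z - Re x)" for x y z
        by (simp add: orient_def algebra_simps)
      then have [measurable]: "(\<lambda>\<omega>. orient (X a \<omega>) (X b \<omega>) (X c \<omega>)) \<in> borel_measurable M"
        by simp
      show "Measurable.pred M (\<lambda>\<omega>. c \<noteq> a \<longrightarrow> c \<noteq> b \<longrightarrow> orient (X a \<omega>) (X b \<omega>) (X c \<omega>) > 0)"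
        by (intro pred_intros_imp') measurable
    qed simp
    have eq: "((a, b) \<in> succ_pairs n (\<lambda>i. X i \<omega>)) \<longleftrightarrow>
      a \<noteq> b \<and> (\<forall>c\<in>{..<n}. c \<noteq> a \<longrightarrow> c \<noteq> b \<longrightarrow> orient (X a \<omega>) (X b \<omega>) (X c \<omega>) > 0)" for \<omega>
      using that by (auto simp: succ_pairs_def)
    show ?thesis unfolding eq by (intro pred_intros_conj1' A)
  qed
  have sub: "succ_pairs n x \<subseteq> {..<n} \<times> {..<n}" for x
    unfolding succ_pairs_def by blast
  have "(\<lambda>\<omega>. succ_pairs n (\<lambda>i. X i \<omega>)) -` {E} \<inter> space M \<in> sets M" if E: "E \<subseteq> {..<n} \<times> {..<n}" for E
  proof -
    have "succ_pairs n x = E \<longleftrightarrow> (\<forall>e\<in>{..<n} \<times> {..<n}. e \<in> succ_pairs n x \<longleftrightarrow> e \<in> E)" for x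
      using E sub[of x] by blast
    then have "(\<lambda>\<omega>. succ_pairs n (\<lambda>i. X i \<omega>)) -` {E} \<inter> space M
      = {\<omega> \<in> space M. \<forall>e\<in>{..<n} \<times> {..<n}. e \<in> succ_pairs n (\<lambda>i. X i \<omega>) \<longleftrightarrow> e \<in> E}"
      by blast
    moreover have "Measurable.pred M (\<lambda>\<omega>. \<forall>e\<in>{..<n} \<times> {..<n}. e \<in> succ_pairs n (\<lambda>i. X i \<omega>) \<longleftrightarrow> e \<in> E)"
    proof (rule pred_intros_finite(3))
      fix e assume "e \<in> {..<n} \<times> {..<n}"
      then obtain a b where "e = (a, b)" "a < n" "b < n" by auto
      then have "Measurable.pred M (\<lambda>\<omega>. e \<in> succ_pairs n (\<lambda>i. X i \<omega>))" using A by simp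
      then show "Measurable.pred M (\<lambda>\<omega>. e \<in> succ_pairs n (\<lambda>i. X i \<omega>) \<longleftrightarrow> e \<in> E)"
        by (cases "e \<in> E") simp_all
    qed simp
    ultimately show ?thesis by (simp only: pred_def)
  qed
  then show ?thesis
    by (subst measurable_count_space_eq2) (use sub in auto)
qed

text \<open>The index set of the cells depends on the outcome, but it takes only finitely many
  values. For each fixed value \<open>E\<close> the count runs over a fixed finite family, and the
  pieces are glued along the measurable map \<open>succ_pairs\<close>.\<close>

lemma measurable_H:
  assumes X: "\<And>i. i < n \<Longrightarrow> X i \<in> borel_measurable M"
    and lab: "\<And>\<omega>. \<omega> \<in> space M \<Longrightarrow> ccw_labelling n (\<lambda>i. X i \<omega>) (P \<omega>)" and n: "n \<ge> 2"
  shows "(\<lambda>\<omega>. H k n (P \<omega>)) \<in> measurable M (count_space UNIV)"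
proof -
  define Q where "Q E A \<omega> \<longleftrightarrow> cell (edge_vec (\<lambda>i. X i \<omega>)) E A \<noteq> {} \<and>
    card {j \<in> {..<n}. X j \<omega> \<in> cell (edge_vec (\<lambda>i. X i \<omega>)) E A \<or> - X j \<omega> \<in> cell (edge_vec (\<lambda>i. X i \<omega>)) E A} = k"
    for E A \<omega>
  have Q: "Measurable.pred M (Q E A)" if E: "E \<subseteq> {..<n} \<times> {..<n}" for E A
  proof -
    have fin: "finite E" using E finite_subset by blast
    have ev: "(\<lambda>\<omega>. edge_vec (\<lambda>i. X i \<omega>) e) \<in> borel_measurable M" if "e \<in> E" for e
    proof -
      obtain a b where "e = (a, b)" "a < n" "b < n" using \<open>e \<in> E\<close> E by auto
      then show ?thesis using X by (simp add: edge_vec_def)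
    qed
    have [measurable]: "Measurable.pred M (\<lambda>\<omega>. cell (edge_vec (\<lambda>i. X i \<omega>)) E A \<noteq> {})"
      by (rule pred_cell_nonempty[OF ev fin])
    have [measurable]: "(\<lambda>\<omega>. card {j \<in> {..<n}. X j \<omega> \<in> cell (edge_vec (\<lambda>i. X i \<omega>)) E A \<or>
        - X j \<omega> \<in> cell (edge_vec (\<lambda>i. X i \<omega>)) E A}) \<in> measurable M (count_space UNIV)"
      using X by (intro measurable_card_Collect pred_intros_logic pred_mem_cell[OF _ ev fin]) auto
    show ?thesis unfolding Q_def by measurable
  qed
  have "Measurable.pred M (\<lambda>\<omega>. \<forall>i\<in>{..<n}. \<forall>j\<in>{..<n}. X i \<omega> = X j \<omega> \<longrightarrow> i = j)"
  proof (intro pred_intros_finite(3))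
    fix i j assume "i \<in> {..<n}" "j \<in> {..<n}"
    then have [measurable]: "X i \<in> borel_measurable M" "X j \<in> borel_measurable M" using X by auto
    show "Measurable.pred M (\<lambda>\<omega>. X i \<omega> = X j \<omega> \<longrightarrow> i = j)" by measurable
  qed auto
  then have [measurable]: "Measurable.pred M (\<lambda>\<omega>. inj_on (\<lambda>i. X i \<omega>) {..<n})"
    by (simp add: inj_on_def)
  have [measurable]: "(\<lambda>\<omega>. card {A \<in> Pow (succ_pairs n (\<lambda>i. X i \<omega>)). Q (succ_pairs n (\<lambda>i. X i \<omega>)) A \<omega>})
    \<in> measurable M (count_space UNIV)"
  proof (rule measurable_compose_countable'[where g = "\<lambda>\<omega>. succ_pairs n (\<lambda>i. X i \<omega>)"])
    show "(\<lambda>\<omega>. card {A \<in> Pow E. Q E A \<omega>}) \<in> measurable M (count_space UNIV)"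
      if "E \<in> Pow ({..<n} \<times> {..<n})" for E
      using that Q by (intro measurable_card_Collect) (auto intro: finite_subset)
    show "(\<lambda>\<omega>. succ_pairs n (\<lambda>i. X i \<omega>)) \<in> measurable M (count_space (Pow ({..<n} \<times> {..<n})))"
      using measurable_succ_pairs X by blast
  qed (simp add: countable_finite)
  have "(\<lambda>\<omega>. if inj_on (\<lambda>i. X i \<omega>) {..<n}
      then card {A \<in> Pow (succ_pairs n (\<lambda>i. X i \<omega>)). Q (succ_pairs n (\<lambda>i. X i \<omega>)) A \<omega>} else 0)
    \<in> measurable M (count_space UNIV)"
    by measurable
  also have "?this \<longleftrightarrow> ?thesis"
  proof (rule measurable_cong)
    fix \<omega> assume \<omega>: "\<omega> \<in> space M"
    have neg: "z \<in> uminus ` C \<longleftrightarrow> - z \<in> C" for z :: complex and C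
      by (metis image_eqI imageE minus_minus)
    show "(if inj_on (\<lambda>i. X i \<omega>) {..<n}
      then card {A \<in> Pow (succ_pairs n (\<lambda>i. X i \<omega>)). Q (succ_pairs n (\<lambda>i. X i \<omega>)) A \<omega>} else 0) = H k n (P \<omega>)"
      using H_collision[OF lab[OF \<omega>]] H_succ_pairs[OF lab[OF \<omega>] _ n, of k]
      by (simp add: Q_def neg)
  qed
  finally show ?thesis .
qed

section \<open>The uniform distribution on the circle\<close>

text \<open>The law \<open>uniform_circle\<close>, transported to the Borel sets of the whole plane.\<close>

definition circ :: "complex measure" where
  "circ = distr (uniform_measure lborel {0..<2 * pi}) borel cis"

lemma sets_circ [measurable_cong, simp]: "sets circ = sets borel"
  and space_circ [simp]: "space circ = UNIV"
  by (simp_all add: circ_def)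

lemma borel_measurable_cis [measurable]: "cis \<in> borel_measurable borel"
  by (intro borel_measurable_continuous_onI continuous_intros)

lemma prob_space_circ: "prob_space circ"
  unfolding circ_def
  by (intro prob_space.prob_space_distr prob_space_uniform_measure) auto

lemma nn_integral_circ:
  assumes [measurable]: "f \<in> borel_measurable borel"
  shows "(\<integral>\<^sup>+z. f z \<partial>circ) = (\<integral>\<^sup>+x. f (cis x) * indicator {0..<2 * pi} x \<partial>lborel) / ennreal (2 * pi)"
  unfolding circ_def by (subst nn_integral_distr) (simp_all add: nn_integral_uniform_measure)

lemma emeasure_circ:
  assumes [measurable]: "A \<in> sets borel"
  shows "emeasure circ A = emeasure lborel {x \<in> {0..<2 * pi}. cis x \<in> A} / ennreal (2 * pi)"
proof -
  have "(\<integral>\<^sup>+x. indicator A (cis x) * indicator {0..<2 * pi} x \<partial>lborel)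
      = (\<integral>\<^sup>+x. indicator {x \<in> {0..<2 * pi}. cis x \<in> A} x \<partial>lborel)"
    by (intro nn_integral_cong) (auto split: split_indicator)
  also have "\<dots> = emeasure lborel {x \<in> {0..<2 * pi}. cis x \<in> A}"
    by (rule nn_integral_indicator) measurable
  finally show ?thesis
    using nn_integral_circ[of "indicator A"] by simp
qed

lemma AE_circ_norm: "AE z in circ. norm z = 1"
  unfolding circ_def by (subst AE_distr_iff) auto

lemma emeasure_circ_singleton: "emeasure circ {z} = 0"
proof -
  have sub: "{x \<in> {0..<2 * pi}. cis x \<in> {z}} \<subseteq> {x}" if "x \<in> {0..<2 * pi}" "cis x = z" for x
  proof
    fix y assume "y \<in> {x \<in> {0..<2 * pi}. cis x \<in> {z}}"
    then have y: "0 \<le> y" "y < 2 * pi" "cis y = cis x" using that by auto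
    then show "y \<in> {x}"
      using that cis_eq_iff_less_2pi[of x y] cis_eq_iff_less_2pi[of y x] by (cases "x \<le> y") auto
  qed
  have "finite {x \<in> {0..<2 * pi}. cis x \<in> {z}}"
  proof (cases "{x \<in> {0..<2 * pi}. cis x \<in> {z}} = {}")
    case False
    then obtain x where "x \<in> {0..<2 * pi}" "cis x = z" by blast
    from sub[OF this] show ?thesis by (rule finite_subset) simp
  next
    case True
    then show ?thesis by (simp only: finite.emptyI)
  qed
  then have "emeasure lborel {x \<in> {0..<2 * pi}. cis x \<in> {z}} = 0"
    by (rule emeasure_lborel_countable[OF countable_finite])
  then show ?thesis by (simp add: emeasure_circ)
qed

text \<open>Rotation shifts the angular interval by \<open>\<alpha>\<close>; the part beyond
  \<open>2 * pi\<close> is folded back to the start by periodicity.\<close>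

lemma nn_integral_circ_rotate:
  assumes [measurable]: "f \<in> borel_measurable borel" and c: "norm c = 1"
  shows "(\<integral>\<^sup>+z. f (c * z) \<partial>circ) = (\<integral>\<^sup>+z. f z \<partial>circ)"
proof -
  define \<alpha> where "\<alpha> = Arg2pi c"
  have \<alpha>: "0 \<le> \<alpha>" "\<alpha> < 2 * pi" and c_eq: "c = cis \<alpha>"
    using Arg2pi_ge_0[of c] Arg2pi_lt_2pi[of c] Arg2pi_eq[of c] c by (auto simp: \<alpha>_def cis_conv_exp)
  define g where "g x = f (cis x)" for x
  have [measurable]: "g \<in> borel_measurable borel" unfolding g_def by measurable
  have g: "g (2 * pi + x) = g x" "g (x + 2 * pi) = g x" for x by (simp_all add: g_def cis_mult[symmetric])
  have "(\<integral>\<^sup>+x. g x * indicator {\<alpha>..<\<alpha> + 2 * pi} x \<partial>lborel)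
      = (\<integral>\<^sup>+x. g (\<alpha> + x) * indicator {\<alpha>..<\<alpha> + 2 * pi} (\<alpha> + x) \<partial>lborel)"
    by (subst nn_integral_real_affine[of _ 1 \<alpha>]) auto
  also have "\<dots> = (\<integral>\<^sup>+x. f (c * cis x) * indicator {0..<2 * pi} x \<partial>lborel)"
    by (intro nn_integral_cong) (auto simp: g_def c_eq cis_mult split: split_indicator)
  finally have 1: "(\<integral>\<^sup>+x. f (c * cis x) * indicator {0..<2 * pi} x \<partial>lborel)
      = (\<integral>\<^sup>+x. g x * indicator {\<alpha>..<\<alpha> + 2 * pi} x \<partial>lborel)" ..
  have "(\<integral>\<^sup>+x. g x * indicator {2 * pi..<2 * pi + \<alpha>} x \<partial>lborel)
      = (\<integral>\<^sup>+x. g (2 * pi + x) * indicator {2 * pi..<2 * pi + \<alpha>} (2 * pi + x) \<partial>lborel)"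
    by (subst nn_integral_real_affine[of _ 1 "2 * pi"]) auto
  also have "\<dots> = (\<integral>\<^sup>+x. g x * indicator {0..<\<alpha>} x \<partial>lborel)"
    by (intro nn_integral_cong) (auto simp: g split: split_indicator)
  finally have 2: "(\<integral>\<^sup>+x. g x * indicator {2 * pi..<2 * pi + \<alpha>} x \<partial>lborel)
      = (\<integral>\<^sup>+x. g x * indicator {0..<\<alpha>} x \<partial>lborel)" .
  have "(\<integral>\<^sup>+x. g x * indicator {\<alpha>..<\<alpha> + 2 * pi} x \<partial>lborel)
      = (\<integral>\<^sup>+x. g x * indicator {\<alpha>..<2 * pi} x + g x * indicator {2 * pi..<2 * pi + \<alpha>} x \<partial>lborel)"
    using \<alpha> by (intro nn_integral_cong) (auto split: split_indicator)
  also have "\<dots> = (\<integral>\<^sup>+x. g x * indicator {\<alpha>..<2 * pi} x \<partial>lborel) + (\<integral>\<^sup>+x. g x * indicator {0..<\<alpha>} x \<partial>lborel)"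
    by (subst nn_integral_add) (auto simp: 2)
  also have "\<dots> = (\<integral>\<^sup>+x. g x * indicator {\<alpha>..<2 * pi} x + g x * indicator {0..<\<alpha>} x \<partial>lborel)"
    by (subst nn_integral_add) auto
  also have "\<dots> = (\<integral>\<^sup>+x. g x * indicator {0..<2 * pi} x \<partial>lborel)"
    using \<alpha> by (intro nn_integral_cong) (auto split: split_indicator)
  finally have "(\<integral>\<^sup>+x. f (c * cis x) * indicator {0..<2 * pi} x \<partial>lborel)
      = (\<integral>\<^sup>+x. f (cis x) * indicator {0..<2 * pi} x \<partial>lborel)"
    unfolding 1 by (simp add: g_def)
  then show ?thesis by (simp add: nn_integral_circ)
qed

section \<open>The arcs left to the other points\<close>

definition nearer_region :: "complex \<Rightarrow> complex \<Rightarrow> complex set" where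
  "nearer_region u v = {w. u \<bullet> v < u \<bullet> w \<and> u \<bullet> v < v \<bullet> w}"

lemma nearer_region_measurable [measurable]: "nearer_region u v \<in> sets borel"
proof -
  have "nearer_region u v = {w. u \<bullet> w > u \<bullet> v} \<inter> {w. v \<bullet> w > u \<bullet> v}"
    by (auto simp: nearer_region_def)
  moreover have "open \<dots>" by (intro open_Int open_halfspace_gt)
  ultimately show ?thesis by (simp add: borel_open)
qed

lemma emeasure_nearer_region_rotate:
  assumes "norm u = 1"
  shows "emeasure circ (nearer_region u v) = emeasure circ (nearer_region 1 (cnj u * v))"
proof -
  have u: "Re u * Re u + Im u * Im u = 1"
    using assms by (simp add: cmod_def power2_eq_square)
  have in1: "u \<bullet> (u * w) = 1 \<bullet> w" for w
  proof -
    have "Re u * (Re u * Re w - Im u * Im w) + Im u * (Re u * Im w + Im u * Re w) = Re w"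
      using u by algebra
    then show ?thesis by (simp add: inner_complex_def)
  qed
  have in2: "v \<bullet> (u * w) = (cnj u * v) \<bullet> w" "u \<bullet> v = 1 \<bullet> (cnj u * v)" for w
    by (simp_all add: inner_complex_def algebra_simps)
  have "emeasure circ (nearer_region u v) = (\<integral>\<^sup>+w. indicator (nearer_region u v) (u * w) \<partial>circ)"
    using assms by (subst nn_integral_circ_rotate) (auto simp: nearer_region_measurable)
  also have "\<dots> = (\<integral>\<^sup>+w. indicator (nearer_region 1 (cnj u * v)) w \<partial>circ)"
    by (intro nn_integral_cong) (simp add: nearer_region_def indicator_def in1 in2)
  finally show ?thesis by simp
qed

lemma emeasure_lborel_Ioo_ennreal: "emeasure lborel {a<..<b::real} = ennreal (b - a)"
  by (cases "a \<le> b") (auto simp: ennreal_neg)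

text \<open>The region is a union of at most two arcs; with \<open>b = min \<beta> (2 * pi - \<beta>)\<close> they have lengths
  \<open>b\<close> and \<open>max 0 (3 * b - 2 * pi)\<close>.\<close>

definition arc_length :: "real \<Rightarrow> real" where
  "arc_length \<beta> = (let b = min \<beta> (2 * pi - \<beta>) in max b (4 * b - 2 * pi))"

lemma emeasure_nearer_region:
  assumes \<beta>: "0 < \<beta>" "\<beta> < 2 * pi"
  shows "emeasure circ (nearer_region 1 (cis \<beta>)) = ennreal (arc_length \<beta> / (2 * pi))"
proof -
  have nr: "cis \<gamma> \<in> nearer_region 1 (cis \<beta>) \<longleftrightarrow> cos \<beta> < cos \<gamma> \<and> cos \<beta> < cos (\<gamma> - \<beta>)" for \<gamma>
    using inner_cis[of 0 \<beta>] inner_cis[of 0 \<gamma>] inner_cis[of \<beta> \<gamma>] by (simp add: nearer_region_def)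
  have iff: "cis \<gamma> \<in> nearer_region 1 (cis \<beta>) \<longleftrightarrow> \<bar>\<beta> - pi\<bar> < \<bar>\<gamma> - pi\<bar> \<and>
      (if \<beta> \<le> \<gamma> then \<bar>\<beta> - pi\<bar> < \<bar>\<gamma> - \<beta> - pi\<bar> else \<bar>\<beta> - pi\<bar> < \<bar>\<gamma> - \<beta> + pi\<bar>)"
    if \<gamma>: "0 \<le> \<gamma>" "\<gamma> < 2 * pi" for \<gamma>
  proof -
    \<comment> \<open>For \<open>\<gamma> < \<beta>\<close> the difference is raised by a turn, to
      the range where cosines are compared by the distance to pi.\<close>
    have "cos (\<gamma> - \<beta>) = cos (\<gamma> - \<beta> + 2 * pi)" by simp
    then show ?thesis
      unfolding nr using \<beta> \<gamma> cos_less_iff_dist_pi[of \<beta> \<gamma>] cos_less_iff_dist_pi[of \<beta> "\<gamma> - \<beta>"]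
        cos_less_iff_dist_pi[of \<beta> "\<gamma> - \<beta> + 2 * pi"] by (auto simp: not_le)
  qed
  have "emeasure lborel {x \<in> {0..<2 * pi}. cis x \<in> nearer_region 1 (cis \<beta>)} = ennreal (arc_length \<beta>)"
  proof (cases "\<beta> \<le> pi")
    case True
    \<comment> \<open>The first arc joins the two points. The second is centred at
      \<open>pi + \<beta> / 2\<close>, opposite to the middle of the first, and is empty for
      \<open>3 * \<beta> \<le> 2 * pi\<close>.\<close>
    have "{x \<in> {0..<2 * pi}. cis x \<in> nearer_region 1 (cis \<beta>)} = {0<..<\<beta>} \<union> {2 * pi - \<beta><..<2 * \<beta>}"
      using \<beta> True by (auto simp: iff abs_if split: if_splits)
    moreover have "emeasure lborel ({0<..<\<beta>} \<union> {2 * pi - \<beta><..<2 * \<beta>})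
        = emeasure lborel {0<..<\<beta>} + emeasure lborel {2 * pi - \<beta><..<2 * \<beta>}"
      using True by (intro plus_emeasure[symmetric]) auto
    \<comment> \<open>\<open>ennreal\<close> sends negative lengths to 0, which matches the maximum
      in \<open>arc_length\<close>.\<close>
    moreover have "ennreal \<beta> + ennreal (3 * \<beta> - 2 * pi) = ennreal (arc_length \<beta>)"
      using True \<beta>
      by (cases "3 * \<beta> \<le> 2 * pi") (auto simp: arc_length_def Let_def min_def max_def ennreal_neg ennreal_plus[symmetric] simp del: ennreal_plus)
    ultimately show ?thesis by (simp add: emeasure_lborel_Ioo_ennreal)
  next
    case False
    \<comment> \<open>The mirror image of the previous case under
      \<open>\<beta> \<mapsto> 2 * pi - \<beta>\<close>.\<close>
    have "{x \<in> {0..<2 * pi}. cis x \<in> nearer_region 1 (cis \<beta>)} = {\<beta><..<2 * pi} \<union> {2 * \<beta> - 2 * pi<..<2 * pi - \<beta>}"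
      using \<beta> False by (auto simp: iff abs_if split: if_splits)
    moreover have "emeasure lborel ({\<beta><..<2 * pi} \<union> {2 * \<beta> - 2 * pi<..<2 * pi - \<beta>})
        = emeasure lborel {\<beta><..<2 * pi} + emeasure lborel {2 * \<beta> - 2 * pi<..<2 * pi - \<beta>}"
      using False by (intro plus_emeasure[symmetric]) auto
    moreover have "ennreal (2 * pi - \<beta>) + ennreal (4 * pi - 3 * \<beta>) = ennreal (arc_length \<beta>)"
      using False \<beta>
      by (cases "4 * pi \<le> 3 * \<beta>") (auto simp: arc_length_def Let_def min_def max_def ennreal_neg ennreal_plus[symmetric] simp del: ennreal_plus)
    ultimately show ?thesis by (simp add: emeasure_lborel_Ioo_ennreal)
  qed
  moreover have "arc_length \<beta> \<ge> 0" using \<beta> by (auto simp: arc_length_def Let_def)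
  ultimately show ?thesis by (simp add: emeasure_circ divide_ennreal)
qed

lemma has_integral_affine_power:
  fixes a b x y :: real
  assumes "a \<noteq> 0" "x \<le> y"
  shows "((\<lambda>t. (a * t + b) ^ m) has_integral
    ((a * y + b) ^ Suc m - (a * x + b) ^ Suc m) / (a * real (Suc m))) {x..y}"
proof -
  have "((\<lambda>t. (a * t + b) ^ Suc m / (a * real (Suc m))) has_vector_derivative (a * t + b) ^ m) (at t within {x..y})" for t
  proof -
    have "((\<lambda>t. a * t + b) has_real_derivative a) (at t within {x..y})"
      by (auto intro!: derivative_eq_intros)
    from DERIV_cdivide[OF DERIV_power[OF this, of "Suc m"], of "a * real (Suc m)"]
    have "((\<lambda>t. (a * t + b) ^ Suc m / (a * real (Suc m))) has_real_derivative
        real (Suc m) * (a * (a * t + b) ^ m) / (a * real (Suc m))) (at t within {x..y})" by simp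
    also have "real (Suc m) * (a * (a * t + b) ^ m) / (a * real (Suc m)) = (a * t + b) ^ m"
      using assms(1) nonzero_mult_div_cancel_left[of "a * real (Suc m)" "(a * t + b) ^ m"]
      by (simp add: mult_ac del: of_nat_Suc)
    finally show ?thesis by (simp only: has_real_derivative_iff_has_vector_derivative)
  qed
  then have "((\<lambda>t. (a * t + b) ^ m) has_integral
     (a * y + b) ^ Suc m / (a * real (Suc m)) - (a * x + b) ^ Suc m / (a * real (Suc m))) {x..y}"
    by (intro fundamental_theorem_of_calculus assms(2)) auto
  then show ?thesis by (simp only: diff_divide_distrib)
qed

text \<open>The integrand is a power of a piecewise affine function: it rises from 0 to 1/3 at
  \<open>2 * pi / 3\<close> and on to 1 at \<open>pi\<close>, then falls symmetrically. In the sum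
  of the four pieces the terms with \<open>r\<close> combine to \<open>3 * r\<close>, which lowers
  the exponent of 1/3 from \<open>Suc m\<close> to \<open>m\<close>.\<close>

lemma has_integral_arc_length_power:
  "((\<lambda>\<beta>. (arc_length \<beta> / (2 * pi)) ^ m) has_integral (pi / real (Suc m) * (1 + 1 / 3 ^ m))) {0..2 * pi}"
proof -
  define r where "r = (1 / 3 :: real) ^ Suc m"
  define f where "f \<beta> = (arc_length \<beta> / (2 * pi)) ^ m" for \<beta>
  have 1: "(f has_integral (2 * pi / real (Suc m) * r)) {0..2 * pi / 3}"
  proof (rule has_integral_eq)
    show "((\<lambda>t. (1 / (2 * pi) * t + 0) ^ m) has_integral (2 * pi / real (Suc m) * r)) {0..2 * pi / 3}"
      using has_integral_affine_power[of "1 / (2 * pi)" 0 "2 * pi / 3" 0 m] by (simp add: r_def mult_ac)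
    show "(1 / (2 * pi) * t + 0) ^ m = f t" if "t \<in> {0..2 * pi / 3}" for t
    proof -
      have "t \<le> 2 * pi - t" "4 * t - 2 * pi \<le> t" using that pi_gt_zero by auto
      then have "arc_length t = t" by (simp add: arc_length_def min_absorb1 max_absorb1)
      then show ?thesis by (simp add: f_def)
    qed
  qed
  have 2: "(f has_integral (pi / (2 * real (Suc m)) * (1 - r))) {2 * pi / 3..pi}"
  proof (rule has_integral_eq)
    show "((\<lambda>t. (2 / pi * t + - 1) ^ m) has_integral (pi / (2 * real (Suc m)) * (1 - r))) {2 * pi / 3..pi}"
      using has_integral_affine_power[of "2 / pi" "2 * pi / 3" pi "- 1" m] by (simp add: r_def mult_ac)
    show "(2 / pi * t + - 1) ^ m = f t" if "t \<in> {2 * pi / 3..pi}" for t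
    proof -
      have "arc_length t = 4 * t - 2 * pi" using that by (auto simp: arc_length_def Let_def min_def max_def)
      moreover have "2 / pi * t + - 1 = (4 * t - 2 * pi) / (2 * pi)" by (simp add: field_simps)
      ultimately show ?thesis by (simp only: f_def)
    qed
  qed
  have 3: "(f has_integral (pi / (2 * real (Suc m)) * (1 - r))) {pi..4 * pi / 3}"
  proof (rule has_integral_eq)
    have "(r - 1) / (- 2 / pi * real (Suc m)) = pi / (2 * real (Suc m)) * (1 - r)"
      by (simp add: field_simps)
    then show "((\<lambda>t. (- 2 / pi * t + 3) ^ m) has_integral (pi / (2 * real (Suc m)) * (1 - r))) {pi..4 * pi / 3}"
      using has_integral_affine_power[of "- 2 / pi" pi "4 * pi / 3" 3 m] by (simp add: r_def mult_ac)
    show "(- 2 / pi * t + 3) ^ m = f t" if "t \<in> {pi..4 * pi / 3}" for t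
    proof -
      have "arc_length t = 6 * pi - 4 * t" using that by (auto simp: arc_length_def Let_def min_def max_def)
      moreover have "- 2 / pi * t + 3 = (6 * pi - 4 * t) / (2 * pi)" by (simp add: field_simps)
      ultimately show ?thesis by (simp only: f_def)
    qed
  qed
  have 4: "(f has_integral (2 * pi / real (Suc m) * r)) {4 * pi / 3..2 * pi}"
  proof (rule has_integral_eq)
    have "(0 - r) / (- 1 / (2 * pi) * real (Suc m)) = 2 * pi / real (Suc m) * r"
      by (simp add: field_simps)
    then show "((\<lambda>t. (- 1 / (2 * pi) * t + 1) ^ m) has_integral (2 * pi / real (Suc m) * r)) {4 * pi / 3..2 * pi}"
      using has_integral_affine_power[of "- 1 / (2 * pi)" "4 * pi / 3" "2 * pi" 1 m] by (simp add: r_def mult_ac)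
    show "(- 1 / (2 * pi) * t + 1) ^ m = f t" if "t \<in> {4 * pi / 3..2 * pi}" for t
    proof -
      have "arc_length t = 2 * pi - t" using that by (auto simp: arc_length_def Let_def min_def max_def)
      moreover have "- 1 / (2 * pi) * t + 1 = (2 * pi - t) / (2 * pi)" by (simp add: field_simps)
      ultimately show ?thesis by (simp only: f_def)
    qed
  qed
  have "(f has_integral (2 * pi / real (Suc m) * r + pi / (2 * real (Suc m)) * (1 - r))) {0..pi}"
    by (rule has_integral_combine[OF _ _ 1 2]) auto
  moreover have "(f has_integral (pi / (2 * real (Suc m)) * (1 - r) + 2 * pi / real (Suc m) * r)) {pi..2 * pi}"
    by (rule has_integral_combine[OF _ _ 3 4]) auto
  ultimately have "(f has_integral (2 * pi / real (Suc m) * r + pi / (2 * real (Suc m)) * (1 - r)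
      + (pi / (2 * real (Suc m)) * (1 - r) + 2 * pi / real (Suc m) * r))) {0..2 * pi}"
    by (rule has_integral_combine[rotated 2]) auto
  moreover have "2 * pi / k * r + pi / (2 * k) * (1 - r) + (pi / (2 * k) * (1 - r) + 2 * pi / k * r)
      = pi / k * (1 + 3 * r)" if "k \<noteq> 0" for k
    using that by (simp add: field_simps)
  then have "2 * pi / real (Suc m) * r + pi / (2 * real (Suc m)) * (1 - r)
      + (pi / (2 * real (Suc m)) * (1 - r) + 2 * pi / real (Suc m) * r) = pi / real (Suc m) * (1 + 3 * r)"
    by (simp only: of_nat_eq_0_iff nat.simps not_False_eq_True)
  moreover have "3 * r = 1 / 3 ^ m" by (simp add: r_def power_one_over)
  ultimately show ?thesis unfolding f_def by (simp only:)
qed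

text \<open>By rotation invariance \<open>u\<close> may be taken to be 1, after which only the angle
  of \<open>v\<close> is integrated.\<close>

lemma nn_integral_nearer_region_power:
  assumes u: "norm u = 1"
  shows "(\<integral>\<^sup>+v. emeasure circ (nearer_region u v) ^ m \<partial>circ) = ennreal ((1 + 1 / 3 ^ m) / (2 * real (Suc m)))"
proof -
  interpret prob_space circ by (rule prob_space_circ)
  define h where "h v = emeasure circ (nearer_region 1 v) ^ m" for v
  \<comment> \<open>The regions are the sections of one jointly measurable set, so their measure
    depends measurably on \<open>v\<close>.\<close>
  have "Measurable.pred (borel \<Otimes>\<^sub>M borel) (\<lambda>(v, w). w \<in> nearer_region 1 v)"
    unfolding nearer_region_def mem_Collect_eq by measurable
  then have [measurable]: "{x \<in> space (borel \<Otimes>\<^sub>M circ). snd x \<in> nearer_region 1 (fst x)} \<in> sets (borel \<Otimes>\<^sub>M circ)"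
    by (simp add: pred_def case_prod_beta space_pair_measure cong: sets_pair_measure_cong)
  have "(\<lambda>v. emeasure circ (Pair v -` {x \<in> space (borel \<Otimes>\<^sub>M circ). snd x \<in> nearer_region 1 (fst x)})) \<in> borel_measurable borel"
    by (intro measurable_emeasure_Pair) measurable
  moreover have "Pair v -` {x \<in> space (borel \<Otimes>\<^sub>M circ). snd x \<in> nearer_region 1 (fst x)} = nearer_region 1 v" for v
    by (auto simp: space_pair_measure)
  ultimately have [measurable]: "h \<in> borel_measurable borel"
    unfolding h_def by simp
  have "(\<integral>\<^sup>+v. emeasure circ (nearer_region u v) ^ m \<partial>circ) = (\<integral>\<^sup>+v. h (cnj u * v) \<partial>circ)"
    unfolding h_def by (simp add: emeasure_nearer_region_rotate[OF u])
  also have "\<dots> = (\<integral>\<^sup>+v. h v \<partial>circ)"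
    using u by (intro nn_integral_circ_rotate) auto
  also have "\<dots> = (\<integral>\<^sup>+\<beta>. h (cis \<beta>) * indicator {0..<2 * pi} \<beta> \<partial>lborel) / ennreal (2 * pi)"
    by (rule nn_integral_circ) measurable
  also have "(\<integral>\<^sup>+\<beta>. h (cis \<beta>) * indicator {0..<2 * pi} \<beta> \<partial>lborel)
    = (\<integral>\<^sup>+\<beta>. indicator {0..2 * pi} \<beta> * (arc_length \<beta> / (2 * pi)) ^ m \<partial>lborel)"
  proof (rule nn_integral_cong_AE)
    \<comment> \<open>The arc formula holds for angles strictly between 0 and \<open>2 * pi\<close>;
      the two endpoints form a null set.\<close>
    have "AE \<beta> in lborel. \<beta> \<noteq> 0" "AE \<beta> in lborel. \<beta> \<noteq> 2 * pi" by (rule AE_lborel_singleton)+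
    then show "AE \<beta> in lborel. h (cis \<beta>) * indicator {0..<2 * pi} \<beta>
      = ennreal (indicator {0..2 * pi} \<beta> * (arc_length \<beta> / (2 * pi)) ^ m)"
    proof eventually_elim
      case (elim \<beta>)
      show ?case
      proof (cases "\<beta> \<in> {0..2 * pi}")
        case True
        then have \<beta>: "0 < \<beta>" "\<beta> < 2 * pi" using elim by auto
        moreover have "arc_length \<beta> \<ge> 0" using \<beta> by (auto simp: arc_length_def Let_def)
        ultimately show ?thesis by (simp add: h_def emeasure_nearer_region ennreal_power)
      next
        case False
        then show ?thesis by (auto simp: indicator_def)
      qed
    qed
  qed
  also have "\<dots> = ennreal (pi / real (Suc m) * (1 + 1 / 3 ^ m))"
    by (intro nn_integral_has_integral_lebesgue has_integral_arc_length_power)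
      (auto simp: arc_length_def Let_def)
  also have "\<dots> / ennreal (2 * pi) = ennreal ((1 + 1 / 3 ^ m) / (2 * real (Suc m)))"
  proof -
    have "pi / k * c / (2 * pi) = c / (2 * k)" for k c by simp
    then show ?thesis by (subst divide_ennreal) (auto simp: del: of_nat_Suc)
  qed
  finally show ?thesis .
qed

section \<open>Expectations\<close>

lemma product_prob_space_circ: "product_prob_space (\<lambda>_. circ)"
  by (intro product_prob_spaceI prob_space_circ)

lemma farthest_pair_iff:
  "farthest_pair n x a b \<longleftrightarrow> (\<forall>c\<in>{..<n} - {a, b}. x c \<in> nearer_region (x a) (x b))"
  by (auto simp: farthest_pair_def nearer_region_def)

lemma pred_farthest_pair:
  fixes X :: "nat \<Rightarrow> 'a \<Rightarrow> complex"
  assumes "\<And>i. i < n \<Longrightarrow> X i \<in> borel_measurable M" "a < n" "b < n"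
  shows "Measurable.pred M (\<lambda>\<omega>. farthest_pair n (\<lambda>i. X i \<omega>) a b)"
  unfolding farthest_pair_iff
proof (rule pred_intros_finite(3))
  fix c assume "c \<in> {..<n} - {a, b}"
  then have [measurable]: "X a \<in> borel_measurable M" "X b \<in> borel_measurable M" "X c \<in> borel_measurable M"
    using assms by auto
  show "Measurable.pred M (\<lambda>\<omega>. X c \<omega> \<in> nearer_region (X a \<omega>) (X b \<omega>))"
    unfolding nearer_region_def mem_Collect_eq by measurable
qed simp

text \<open>Fubini with \<open>u\<close> and \<open>v\<close> outermost: once they are fixed, each
  of the other \<open>n - 2\<close> independent points has to fall into the same region, which gives
  the power to be integrated.\<close>

lemma emeasure_farthest_pair:
  assumes ab: "a < n" "b < n" "a \<noteq> b"
  shows "emeasure (\<Pi>\<^sub>M i\<in>{..<n}. circ) {x \<in> space (\<Pi>\<^sub>M i\<in>{..<n}. circ). farthest_pair n x a b}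
    = ennreal ((1 + 1 / 3 ^ (n - 2)) / (2 * real (n - 1)))"
proof -
  interpret C: prob_space circ by (rule prob_space_circ)
  interpret product_prob_space "\<lambda>_. circ" by (rule product_prob_space_circ)
  define J where "J = {..<n} - {a, b}"
  define S where "S = {x \<in> space (\<Pi>\<^sub>M i\<in>{..<n}. circ). farthest_pair n x a b}"
  have I: "{..<n} = insert a (insert b J)" and fin: "finite J" and nJ: "a \<notin> insert b J" "b \<notin> J"
    using ab by (auto simp: J_def)
  have cJ: "card J = n - 2" using ab by (simp add: J_def card_Diff_subset)
  have S: "S \<in> sets (\<Pi>\<^sub>M i\<in>{..<n}. circ)"
    unfolding S_def
    by (intro predE pred_farthest_pair) (use ab in \<open>auto intro!: measurable_component_singleton[where M="\<lambda>_. circ", simplified]\<close>)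
  have inner: "(\<integral>\<^sup>+x. indicator S (x(b := v, a := u)) \<partial>(\<Pi>\<^sub>M i\<in>J. circ))
    = emeasure circ (nearer_region u v) ^ (n - 2)" for u v
  proof -
    have "(\<integral>\<^sup>+x. indicator S (x(b := v, a := u)) \<partial>(\<Pi>\<^sub>M i\<in>J. circ))
      = (\<integral>\<^sup>+x. indicator (Pi\<^sub>E J (\<lambda>_. nearer_region u v)) x \<partial>(\<Pi>\<^sub>M i\<in>J. circ))"
    proof (rule nn_integral_cong)
      fix x assume "x \<in> space (\<Pi>\<^sub>M i\<in>J. circ)"
      then have x: "x \<in> extensional J" by (simp add: space_PiM PiE_def)
      have "x(b := v, a := u) \<in> space (\<Pi>\<^sub>M i\<in>{..<n}. circ)"
        using x by (auto simp: I space_PiM PiE_def extensional_def)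
      moreover have "farthest_pair n (x(b := v, a := u)) a b \<longleftrightarrow> (\<forall>c\<in>J. x c \<in> nearer_region u v)"
        using ab by (auto simp: farthest_pair_iff J_def)
      ultimately have "x(b := v, a := u) \<in> S \<longleftrightarrow> x \<in> Pi\<^sub>E J (\<lambda>_. nearer_region u v)"
        using x by (auto simp: S_def PiE_def Pi_def)
      then show "(indicator S (x(b := v, a := u)) :: ennreal) = indicator (Pi\<^sub>E J (\<lambda>_. nearer_region u v)) x"
        by (simp add: indicator_def)
    qed
    also have "\<dots> = emeasure (\<Pi>\<^sub>M i\<in>J. circ) (Pi\<^sub>E J (\<lambda>_. nearer_region u v))"
      by (intro nn_integral_indicator sets_PiM_I_finite fin) auto
    also have "\<dots> = (\<Prod>i\<in>J. emeasure circ (nearer_region u v))"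
      by (intro emeasure_PiM fin) auto
    finally show ?thesis by (simp add: cJ)
  qed
  have "emeasure (\<Pi>\<^sub>M i\<in>{..<n}. circ) S = (\<integral>\<^sup>+x. indicator S x \<partial>(\<Pi>\<^sub>M i\<in>insert a (insert b J). circ))"
    using S by (simp add: I)
  also have "\<dots> = (\<integral>\<^sup>+u. \<integral>\<^sup>+x. indicator S (x(a := u)) \<partial>(\<Pi>\<^sub>M i\<in>insert b J. circ) \<partial>circ)"
    by (rule product_nn_integral_insert_rev) (use fin nJ S I in auto)
  also have "\<dots> = (\<integral>\<^sup>+u. \<integral>\<^sup>+v. \<integral>\<^sup>+x. indicator S (x(b := v, a := u)) \<partial>(\<Pi>\<^sub>M i\<in>J. circ) \<partial>circ \<partial>circ)"
  proof (rule nn_integral_cong)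
    fix u :: complex
    have "(\<lambda>x. x(a := u)) \<in> measurable (\<Pi>\<^sub>M i\<in>insert b J. circ) (\<Pi>\<^sub>M i\<in>{..<n}. circ)"
      unfolding I by (rule measurable_fun_upd[where J="insert b J"]) auto
    then have "(\<lambda>x. indicator S (x(a := u)) :: ennreal) \<in> borel_measurable (\<Pi>\<^sub>M i\<in>insert b J. circ)"
      by (rule measurable_compose[OF _ borel_measurable_indicator[OF S]])
    then show "(\<integral>\<^sup>+x. indicator S (x(a := u)) \<partial>(\<Pi>\<^sub>M i\<in>insert b J. circ))
      = (\<integral>\<^sup>+v. \<integral>\<^sup>+x. indicator S (x(b := v, a := u)) \<partial>(\<Pi>\<^sub>M i\<in>J. circ) \<partial>circ)"
      using fin nJ by (intro product_nn_integral_insert_rev) auto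
  qed
  also have "\<dots> = (\<integral>\<^sup>+u. \<integral>\<^sup>+v. emeasure circ (nearer_region u v) ^ (n - 2) \<partial>circ \<partial>circ)"
    by (simp add: inner)
  also have "\<dots> = (\<integral>\<^sup>+u. ennreal ((1 + 1 / 3 ^ (n - 2)) / (2 * real (Suc (n - 2)))) \<partial>circ)"
    using AE_circ_norm by (intro nn_integral_cong_AE) (auto simp: nn_integral_nearer_region_power)
  also have "\<dots> = ennreal ((1 + 1 / 3 ^ (n - 2)) / (2 * real (Suc (n - 2))))"
    using C.emeasure_space_1 by simp
  also have "Suc (n - 2) = n - 1" using ab by simp
  finally show ?thesis by (simp add: S_def)
qed

lemma pred_coincidence:
  fixes f g h k :: "'a \<Rightarrow> complex"
  assumes [measurable]: "f \<in> borel_measurable M" "g \<in> borel_measurable M"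
    "h \<in> borel_measurable M" "k \<in> borel_measurable M"
  shows "Measurable.pred M (\<lambda>\<omega>. h \<omega> \<noteq> 0 \<and> k \<omega> * h \<omega> = f \<omega> * g \<omega>)"
  by measurable

text \<open>With all other coordinates fixed, \<open>x d\<close> is confined to the single value
  \<open>x a * x b / x c\<close>, a null set of \<open>circ\<close>. The condition
  \<open>x c \<noteq> 0\<close> permits the division, as the product space ranges over the whole
  plane.\<close>

lemma emeasure_coincidence:
  fixes n :: nat
  assumes "a < n" "b < n" "c < n" "d < n" "d \<noteq> a" "d \<noteq> b" "d \<noteq> c"
  shows "emeasure (\<Pi>\<^sub>M i\<in>{..<n}. circ)
    {x \<in> space (\<Pi>\<^sub>M i\<in>{..<n}. circ). x c \<noteq> 0 \<and> x d * x c = x a * x b} = 0"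
proof -
  interpret product_prob_space "\<lambda>_. circ" by (rule product_prob_space_circ)
  define J where "J = {..<n} - {d}"
  define S where "S = {x \<in> space (\<Pi>\<^sub>M i\<in>{..<n}. circ). x c \<noteq> 0 \<and> x d * x c = x a * x b}"
  have I: "{..<n} = insert d J" using assms by (auto simp: J_def)
  have proj: "(\<lambda>x. x i) \<in> borel_measurable (\<Pi>\<^sub>M i\<in>{..<n}. circ)" if "i < n" for i
    using that by (auto intro!: measurable_component_singleton[where M="\<lambda>_. circ", simplified])
  have S: "S \<in> sets (\<Pi>\<^sub>M i\<in>{..<n}. circ)"
    unfolding S_def by (intro predE pred_coincidence proj assms)
  have "emeasure (\<Pi>\<^sub>M i\<in>{..<n}. circ) S = (\<integral>\<^sup>+x. indicator S x \<partial>(\<Pi>\<^sub>M i\<in>insert d J. circ))"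
    using S by (simp add: I)
  also have "\<dots> = (\<integral>\<^sup>+x. \<integral>\<^sup>+y. indicator S (x(d := y)) \<partial>circ \<partial>(\<Pi>\<^sub>M i\<in>J. circ))"
  proof (rule product_nn_integral_insert)
    show "indicator S \<in> borel_measurable (\<Pi>\<^sub>M i\<in>insert d J. circ)"
      using S unfolding I by (rule borel_measurable_indicator)
  qed (simp_all add: J_def)
  also have "\<dots> = (\<integral>\<^sup>+x. 0 \<partial>(\<Pi>\<^sub>M i\<in>J. circ))"
  proof (rule nn_integral_cong)
    fix x
    have "(\<integral>\<^sup>+y. indicator S (x(d := y)) \<partial>circ) \<le> (\<integral>\<^sup>+y. indicator {x a * x b / x c} y \<partial>circ)"
      using assms by (intro nn_integral_mono) (auto simp: S_def indicator_def field_simps)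
    also have "\<dots> = 0" by (simp add: emeasure_circ_singleton)
    finally show "(\<integral>\<^sup>+y. indicator S (x(d := y)) \<partial>circ) = 0" by simp
  qed
  finally show ?thesis by (simp add: S_def)
qed

theorem theorem7:
  fixes M :: "'a measure"
    and n :: nat
    and X :: "nat \<Rightarrow> 'a \<Rightarrow> complex"
    and P :: "'a \<Rightarrow> nat \<Rightarrow> complex"
  assumes "prob_space M"
    and "n \<ge> 3"
    and "prob_space.indep_vars M (\<lambda>_. restrict_space borel (sphere 0 1)) X {..<n}"
    and "\<And>i. i < n \<Longrightarrow> distr M (restrict_space borel (sphere 0 1)) (X i) = uniform_circle"
    and "\<And>\<omega>. \<omega> \<in> space M \<Longrightarrow> ccw_labelling n (\<lambda>i. X i \<omega>) (P \<omega>)"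
  shows "(\<integral>\<omega>. real (H 0 n (P \<omega>)) \<partial>M) = real n / 2 * (1 + 1 / 3 ^ (n - 2))
       \<and> (\<integral>\<omega>. real (H 2 n (P \<omega>)) \<partial>M) = real n / 2 * (1 + 1 / 3 ^ (n - 2))
       \<and> (\<integral>\<omega>. real (H 1 n (P \<omega>)) \<partial>M) = real n * (1 - 1 / 3 ^ (n - 2))"
proof -
  interpret prob_space M by (rule assms(1))
  let ?S = "restrict_space borel (sphere 0 1) :: complex measure"
  let ?Pi = "\<Pi>\<^sub>M i\<in>{..<n}. circ"
  have rv: "X i \<in> measurable M ?S" if "i < n" for i
    using assms(3) that by (auto simp: indep_vars_def)
  have id: "(\<lambda>z. z) \<in> borel_measurable ?S" by (rule measurable_restrict_space1) simp
  have X: "X i \<in> borel_measurable M" if "i < n" for i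
    using measurable_compose[OF rv[OF that] id] by simp
  have norm: "norm (X i \<omega>) = 1" if "i < n" "\<omega> \<in> space M" for i \<omega>
    using measurable_space[OF rv[OF that(1)] that(2)] by (simp add: space_restrict_space)
  have cis: "cis \<in> measurable (uniform_measure lborel {0..<2 * pi}) ?S"
    by (rule measurable_restrict_space2) auto
  have law: "distr M borel (X i) = circ" if "i < n" for i
  proof -
    have "distr M borel (X i) = distr (distr M ?S (X i)) borel (\<lambda>z. z)"
      using distr_distr[OF id rv[OF that]] by (simp add: comp_def)
    also have "\<dots> = circ"
      unfolding assms(4)[OF that] uniform_circle_def circ_def
      using distr_distr[OF id cis] by (simp add: comp_def)
    finally show ?thesis .
  qed
  \<comment> \<open>Independence together with the common law makes the joint law the product
    measure, so probabilities can be computed with coordinates.\<close>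
  have "indep_vars (\<lambda>_. borel) (\<lambda>i \<omega>. X i \<omega>) {..<n}"
    by (rule indep_vars_compose2[OF assms(3), where Y="\<lambda>_ z. z"]) (rule id)
  moreover have "{..<n} \<noteq> {}" using assms(2) by (auto simp: lessThan_empty_iff)
  ultimately have "distr M (\<Pi>\<^sub>M i\<in>{..<n}. borel) (\<lambda>\<omega>. \<lambda>i\<in>{..<n}. X i \<omega>) = (\<Pi>\<^sub>M i\<in>{..<n}. distr M borel (X i))"
    using X by (subst (asm) indep_vars_iff_distr_eq_PiM') auto
  also have "\<dots> = ?Pi" by (intro PiM_cong) (auto simp: law)
  also have "distr M (\<Pi>\<^sub>M i\<in>{..<n}. borel) (\<lambda>\<omega>. \<lambda>i\<in>{..<n}. X i \<omega>) = distr M ?Pi (\<lambda>\<omega>. \<lambda>i\<in>{..<n}. X i \<omega>)"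
    by (intro distr_cong sets_PiM_cong) auto
  finally have joint: "distr M ?Pi (\<lambda>\<omega>. \<lambda>i\<in>{..<n}. X i \<omega>) = ?Pi" .
  have T: "(\<lambda>\<omega>. \<lambda>i\<in>{..<n}. X i \<omega>) \<in> measurable M ?Pi"
    using X by (intro measurable_restrict) auto
  have transfer: "emeasure M {\<omega> \<in> space M. Q (\<lambda>i\<in>{..<n}. X i \<omega>)} = emeasure ?Pi {x \<in> space ?Pi. Q x}"
    if "{x \<in> space ?Pi. Q x} \<in> sets ?Pi" for Q
  proof -
    have "emeasure ?Pi {x \<in> space ?Pi. Q x} = emeasure (distr M ?Pi (\<lambda>\<omega>. \<lambda>i\<in>{..<n}. X i \<omega>)) {x \<in> space ?Pi. Q x}"
      by (simp add: joint)
    also have "\<dots> = emeasure M ((\<lambda>\<omega>. \<lambda>i\<in>{..<n}. X i \<omega>) -` {x \<in> space ?Pi. Q x} \<inter> space M)"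
      by (rule emeasure_distr[OF T that])
    also have "(\<lambda>\<omega>. \<lambda>i\<in>{..<n}. X i \<omega>) -` {x \<in> space ?Pi. Q x} \<inter> space M = {\<omega> \<in> space M. Q (\<lambda>i\<in>{..<n}. X i \<omega>)}"
      by (auto simp: space_PiM)
    finally show ?thesis ..
  qed
  have proj: "(\<lambda>x. x i) \<in> borel_measurable ?Pi" if "i < n" for i
    using that by (auto intro!: measurable_component_singleton[where M="\<lambda>_. circ", simplified])
  have "AE \<omega> in M. X d \<omega> * X c \<omega> \<noteq> X a \<omega> * X b \<omega>"
    if abcd: "a < n" "b < n" "c < n" "d < n" "d \<noteq> a" "d \<noteq> b" "d \<noteq> c" for a b c d
  proof (rule AE_I')
    have "{x \<in> space ?Pi. x c \<noteq> 0 \<and> x d * x c = x a * x b} \<in> sets ?Pi"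
      by (intro predE pred_coincidence proj abcd)
    from transfer[OF this] emeasure_coincidence[OF abcd]
    have "emeasure M {\<omega> \<in> space M. X c \<omega> \<noteq> 0 \<and> X d \<omega> * X c \<omega> = X a \<omega> * X b \<omega>} = 0"
      using abcd by simp
    moreover have "{\<omega> \<in> space M. X c \<omega> \<noteq> 0 \<and> X d \<omega> * X c \<omega> = X a \<omega> * X b \<omega>} \<in> sets M"
      by (intro predE pred_coincidence X abcd)
    ultimately show "{\<omega> \<in> space M. X c \<omega> \<noteq> 0 \<and> X d \<omega> * X c \<omega> = X a \<omega> * X b \<omega>} \<in> null_sets M"
      by (simp add: null_sets_def)
    \<comment> \<open>The points lie on the circle, so \<open>X c \<omega>\<close> is nonzero at
      every outcome.\<close>
    show "{\<omega> \<in> space M. \<not> X d \<omega> * X c \<omega> \<noteq> X a \<omega> * X b \<omega>}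
        \<subseteq> {\<omega> \<in> space M. X c \<omega> \<noteq> 0 \<and> X d \<omega> * X c \<omega> = X a \<omega> * X b \<omega>}"
      using norm[OF abcd(3)] by fastforce
  qed
  then have "AE \<omega> in M. \<forall>a\<in>{..<n}. \<forall>b\<in>{..<n}. \<forall>c\<in>{..<n}. \<forall>d\<in>{..<n}.
      d \<noteq> a \<longrightarrow> d \<noteq> b \<longrightarrow> d \<noteq> c \<longrightarrow> X d \<omega> * X c \<omega> \<noteq> X a \<omega> * X b \<omega>"
    by (intro AE_finite_allI finite_lessThan AE_impI) auto
  then have gen: "AE \<omega> in M. generic n (\<lambda>i. X i \<omega>)"
    by eventually_elim (auto simp: generic_def)
  define N where "N \<omega> = card (farthest_pairs n (\<lambda>i. X i \<omega>))" for \<omega>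
  define A where "A e = {\<omega> \<in> space M. farthest_pair n (\<lambda>i. X i \<omega>) (fst e) (snd e)}" for e
  define G where "G = {(a, b) \<in> {..<n} \<times> {..<n}. a \<noteq> b}"
  have finG: "finite G" unfolding G_def by (rule finite_subset[of _ "{..<n} \<times> {..<n}"]) auto
  have A: "A e \<in> sets M" if "e \<in> G" for e
    using that unfolding A_def G_def by (auto intro!: predE pred_farthest_pair X)
  define q where "q = (1 + 1 / 3 ^ (n - 2)) / (2 * real (n - 1))"
  have measA: "measure M (A e) = q" if eG: "e \<in> G" for e
  proof -
    obtain a b where e: "e = (a, b)" "a < n" "b < n" "a \<noteq> b" using eG by (auto simp: G_def)
    have "{x \<in> space ?Pi. farthest_pair n x a b} \<in> sets ?Pi"
      by (intro predE pred_farthest_pair proj e)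
    moreover have "farthest_pair n (\<lambda>i\<in>{..<n}. X i \<omega>) a b \<longleftrightarrow> farthest_pair n (\<lambda>i. X i \<omega>) a b" for \<omega>
      using e by (auto simp: farthest_pair_iff)
    ultimately have "emeasure M (A e) = ennreal q"
      using transfer[of "\<lambda>x. farthest_pair n x a b"] emeasure_farthest_pair[OF e(2-4)]
      by (simp add: A_def e(1) q_def)
    moreover have "q \<ge> 0" by (simp add: q_def)
    ultimately show ?thesis by (simp add: measure_def)
  qed
  \<comment> \<open>Writing \<open>N\<close> as a sum of indicators reduces its expectation to
    \<open>n * (n - 1)\<close> copies of the same probability \<open>q\<close>.\<close>
  have N_eq: "real (N \<omega>) = (\<Sum>e\<in>G. indicator (A e) \<omega>)" if "\<omega> \<in> space M" for \<omega>
  proof -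
    have "farthest_pairs n (\<lambda>i. X i \<omega>) = {e \<in> G. \<omega> \<in> A e}"
      using that by (auto simp: farthest_pairs_def G_def A_def)
    then have "real (N \<omega>) = (\<Sum>e\<in>{e \<in> G. \<omega> \<in> A e}. 1)" by (simp add: N_def)
    also have "\<dots> = (\<Sum>e\<in>G. indicator (A e) \<omega>)"
      using finG by (intro sum.mono_neutral_cong_left) (auto simp: indicator_def)
    finally show ?thesis .
  qed
  have int: "integrable M (\<lambda>\<omega>. \<Sum>e\<in>G. indicator (A e) \<omega> :: real)"
    by (intro Bochner_Integration.integrable_sum integrable_real_indicator A) (auto simp: less_top[symmetric])
  have intN: "integrable M (\<lambda>\<omega>. real (N \<omega>))"
    using int by (subst Bochner_Integration.integrable_cong[OF refl N_eq])
  have "(\<integral>\<omega>. real (N \<omega>) \<partial>M) = (\<integral>\<omega>. (\<Sum>e\<in>G. indicator (A e) \<omega>) \<partial>M)"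
    by (intro Bochner_Integration.integral_cong refl N_eq)
  also have "\<dots> = (\<Sum>e\<in>G. \<integral>\<omega>. indicator (A e) \<omega> \<partial>M)"
    by (intro Bochner_Integration.integral_sum integrable_real_indicator A) (auto simp: less_top[symmetric])
  also have "\<dots> = (\<Sum>e\<in>G. q)"
    using A measA by (intro sum.cong) auto
  also have "\<dots> = real (card G) * q" by simp
  also have "card G = n * (n - 1)"
  proof -
    have G_eq: "G = {..<n} \<times> {..<n} - (\<lambda>i. (i, i)) ` {..<n}" by (auto simp: G_def)
    have "card ((\<lambda>i. (i, i)) ` {..<n}) = n" by (simp add: card_image inj_on_def)
    then show ?thesis
      by (subst G_eq, subst card_Diff_subset) (auto simp: card_cartesian_product diff_mult_distrib2)
  qed
  also have "real (n * (n - 1)) * q = real n / 2 * (1 + 1 / 3 ^ (n - 2))"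
  proof -
    have "x * k * (c / (2 * k)) = x / 2 * c" if "k \<noteq> 0" for x k c :: real
      using that by simp
    moreover have "real (n - 1) \<noteq> 0" using assms(2) by simp
    ultimately show ?thesis unfolding q_def of_nat_mult by blast
  qed
  finally have EN: "(\<integral>\<omega>. real (N \<omega>) \<partial>M) = real n / 2 * (1 + 1 / 3 ^ (n - 2))" .
  \<comment> \<open>The labelling \<open>P\<close> carries no measurability assumption of its own,
    while replacing \<open>H\<close> by \<open>N\<close> under the integral needs both to be
    measurable.\<close>
  have mH: "(\<lambda>\<omega>. real (H k n (P \<omega>))) \<in> borel_measurable M" for k
  proof -
    have "n \<ge> 2" using assms(2) by simp
    from measurable_H[OF X assms(5) this] show ?thesis by (rule measurable_compose) simp_all
  qed
  have mN: "(\<lambda>\<omega>. real (N \<omega>)) \<in> borel_measurable M" using intN by simp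
  have "AE \<omega> in M. real (H 0 n (P \<omega>)) = real (N \<omega>) \<and> real (H 2 n (P \<omega>)) = real (N \<omega>) \<and>
      real (H 1 n (P \<omega>)) = 2 * real n - 2 * real (N \<omega>)"
    using gen AE_space
  proof eventually_elim
    case (elim \<omega>)
    note H_generic[OF assms(5)[OF elim(2)] elim(1) assms(2), folded N_def]
    then show ?case by linarith
  qed
  then have ae: "AE \<omega> in M. real (H 0 n (P \<omega>)) = real (N \<omega>)" "AE \<omega> in M. real (H 2 n (P \<omega>)) = real (N \<omega>)"
    "AE \<omega> in M. real (H 1 n (P \<omega>)) = 2 * real n - 2 * real (N \<omega>)"
    by auto
  have "(\<integral>\<omega>. real (H 1 n (P \<omega>)) \<partial>M) = (\<integral>\<omega>. 2 * real n - 2 * real (N \<omega>) \<partial>M)"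
    by (rule integral_cong_AE[OF mH _ ae(3)]) (use mN in simp)
  also have "\<dots> = 2 * real n - 2 * (\<integral>\<omega>. real (N \<omega>) \<partial>M)"
    using intN by (simp add: prob_space)
  also have "\<dots> = real n * (1 - 1 / 3 ^ (n - 2))"
    unfolding EN by (simp add: algebra_simps)
  finally show ?thesis
    using integral_cong_AE[OF mH mN ae(1)] integral_cong_AE[OF mH mN ae(2)] EN by simp
qed

end
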